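(* The algorithm $\mathcal{A}$ described in the context is sound and complete for the problem of causal effect identification from $(\mathcal{G},\mathcal{L}_{\mathcal{C}})$. That is, for every DAG $\mathcal{G}=(\mathbf{V},\mathbf{E})$ with observable variables $\mathbf{N}$, control variables $\mathcal{C}\subseteq\Lambda_{\mathcal{G}}$, label set $\mathcal{L}_{\mathcal{C}}$, and disjoint $\mathbf{T},\mathbf{S}\subseteq\mathbf{N}\setminus\mathcal{C}$: (soundness) whenever $\mathcal{A}$ returns a formula, the causal effect of $\mathbf{T}$ on $\mathbf{S}$ is identifiable from $(\mathcal{G},\mathcal{L}_{\mathcal{C}})$ and the returned formula equals $P^{\mathcal{M}}_{\mathbf{t}}(\mathbf{S})$ for every SEM $\mathcal{M}$ with causal graph $\mathcal{G}$, compatible with $\mathcal{L}_{\mathcal{C}}$, and with $P^{\mathcal{M}}(\mathbf{n})>0$ for all $\mathbf{n}\in D_{\mathbf{N}}$; (completeness) whenever $\mathcal{A}$ returns "non-identifiable", the causal effect of $\mathbf{T}$ on $\mathbf{S}$ is not identifiable from $(\mathcal{G},\mathcal{L}_{\mathcal{C}})$.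
   Context: Variables. All variables are discrete with finite domains; $D_{\mathbf{X}}$ denotes the domain of $\mathbf{X}$. $\mathbf{V}=\mathbf{N}\cup\mathbf{U}$ with $\mathbf{N}$ observable and $\mathbf{U}$ unobservable. $Pa_X$ is the set of parents of $X$ in $\mathcal{G}$. $\Lambda_{\mathcal{G}}$ is the set of observed vertices without parents. The control variables are a set $\mathcal{C}\subseteq\Lambda_{\mathcal{G}}$. $\mathcal{C}^X:=Pa_X\cap\mathcal{C}$, and $\mathbf{c}^X$ is the restriction of $\mathbf{c}\in D_{\mathcal{C}}$ to $\mathcal{C}^X$. SEM. A structural equation model (SEM) $\mathcal{M}$ with causal graph $\mathcal{G}$ generates each $X\in\mathbf{V}$ as $X=f_X(Pa_X,\epsilon_X)$, with $f_X$ deterministic and noises $\epsilon_X$ jointly independent; $P^{\mathcal{M}}$ is the induced distribution. $do(\mathbf{T}=\mathbf{t})$ forces $\mathbf{T}$ to equal $\mathbf{t}$ and eliminates the influence of other variables on $\mathbf{T}$; $P^{\mathcal{M}}_{\mathbf{t}}(\mathbf{s}):=P^{\mathcal{M}}(\mathbf{S}=\mathbf{s}\mid do(\mathbf{T}=\mathbf{t}))$. Label sets. For $\mathbf{c}\in D_{\mathcal{C}}$, $\mathcal{L}_{\mathcal{C}}(\mathbf{c})$ is a set of edges $(Y,X)\in\mathbf{E}$ (with $X,Y\notin\mathcal{C}$) such that $X$ is independent of $Y$ given $\mathcal{C}=\mathbf{c}$ and $\mathbf{S}$, for some $\mathbf{S}\subseteq\mathbf{V}\setminus(\{X,Y\}\cup\mathcal{C})$;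 $\mathcal{L}_{\mathcal{C}}:=(\mathcal{L}_{\mathcal{C}}(\mathbf{c}):\mathbf{c}\in D_{\mathcal{C}})$. A SEM is compatible with $\mathcal{L}_{\mathcal{C}}$ if for every $\mathbf{c}$ and every $(Y,X)\in\mathcal{L}_{\mathcal{C}}(\mathbf{c})$, $X$ is no longer a function of $Y$ when $\mathcal{C}=\mathbf{c}$ (i.e. $f_X$ does not depend on its argument $Y$ once $\mathcal{C}$ is set to $\mathbf{c}$). We write $(Y,X)\in\mathcal{L}_{\mathcal{C}}$ if $(Y,X)\in\mathcal{L}_{\mathcal{C}}(\mathbf{c})$ for some $\mathbf{c}$. Identifiability. The causal effect of $\mathbf{T}$ on $\mathbf{S}$ is identifiable (ID) from a DAG $\mathcal{G}$ (resp. from $(\mathcal{G},\mathcal{L}_{\mathcal{C}})$) if for any $\mathbf{t}\in D_{\mathbf{T}}$, $\mathbf{s}\in D_{\mathbf{S}}$, $P^{\mathcal{M}}_{\mathbf{t}}(\mathbf{s})$ is uniquely computable from $P^{\mathcal{M}}(\mathbf{N})$ in any SEM $\mathcal{M}$ with causal graph $\mathcal{G}$ (resp. and compatible with $\mathcal{L}_{\mathcal{C}}$) such that $P^{\mathcal{M}}(\mathbf{n})>0$ for all $\mathbf{n}\in D_{\mathbf{N}}$. "Uniquely computable" means there exists a continuous operator $\mathcal{F}$ (the same for all the SEMs considered) with $\mathcal{F}(P^{\mathcal{M}}(\mathbf{N}))=P^{\mathcal{M}}_{\mathbf{t}}(\mathbf{s})$. Algorithm $\mathcal{A}$. Input: $\mathcal{G}$,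 $\mathcal{L}_{\mathcal{C}}$ (and $\mathbf{T},\mathbf{S}$). (1) While there is $(Y,X)\in\mathcal{L}_{\mathcal{C}}$ with $\mathcal{C}^X=\varnothing$, delete $(Y,X)$ from $\mathcal{G}$ (and hence from all labels). (2) While there are $\mathbf{c}_1,\mathbf{c}_2\in D_{\mathcal{C}}$ and $(Y,X)\in\mathcal{L}_{\mathcal{C}}(\mathbf{c}_1)$ with $\mathbf{c}_1^X=\mathbf{c}_2^X$ and $(Y,X)\notin\mathcal{L}_{\mathcal{C}}(\mathbf{c}_2)$, add $(Y,X)$ to $\mathcal{L}_{\mathcal{C}}(\mathbf{c}_2)$. (3) Set $\mathbf{V}'=\mathbf{V}\setminus\mathcal{C}$, $\mathbf{N}'=\mathbf{N}\setminus\mathcal{C}$, $\mathbf{E}'=\mathbf{E}\cap(\mathbf{V}'\times\mathbf{V}')$. (4) For each $\mathbf{c}\in D_{\mathcal{C}}$: let $\mathcal{G}_{\mathbf{c}}=(\mathbf{V}',\mathbf{E}'\setminus\mathcal{L}_{\mathcal{C}}(\mathbf{c}))$ with observable variables $\mathbf{N}'$. If $P_{\mathbf{t}}(\mathbf{S})$ is not ID from $\mathcal{G}_{\mathbf{c}}$, return "non-identifiable". Otherwise let $P^{\mathbf{c}}(\mathbf{N}')=P(\mathbf{N}\setminus\mathcal{C}\mid\mathbf{c})$ and let $\mathbf{F}_{\mathbf{c}}$ be a formula for $P_{\mathbf{t}}(\mathbf{S})$ in terms of $P^{\mathbf{c}}(\mathbf{N}')$ using graph $\mathcal{G}_{\mathbf{c}}$.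 (5) Return $\sum_{\mathbf{c}\in D_{\mathcal{C}}}\mathbf{F}_{\mathbf{c}}P(\mathbf{c})$. The test and the formula in step (4) are obtained from a sound and complete procedure for identification from a DAG (such procedures are known, e.g. based on do-calculus).
   Formalization: For identifiability from (G, L_C) the operator must also be continuous at laws P(N) where some contexts c have probability 0 (positive within every other context); with continuity only on strictly positive laws, completeness is false. *)

theory Defs
  imports "HOL-Probability.Probability" "HOL-Library.While_Combinator"
begin

section \<open>Causal graphs\<close>

text \<open>An edge \<open>(Y, X)\<close> points from \<open>Y\<close> to \<open>X\<close>; the unobservable variables are
  \<open>vars G - obs G\<close>. The domain of the variable \<open>X\<close> is the set \<open>D X\<close>, and the domain of a set
  \<open>A\<close> of variables is the set \<open>Pi\<^sub>E A D\<close> of extensional functions on \<open>A\<close>.\<close>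

record 'v cgraph =
  vars :: "'v set"
  obs :: "'v set"
  edges :: "('v \<times> 'v) set"

definition causal_dag :: "('v \<Rightarrow> 'a set) \<Rightarrow> 'v cgraph \<Rightarrow> bool" where
  "causal_dag D G \<longleftrightarrow>
     finite (vars G) \<and> obs G \<subseteq> vars G \<and> edges G \<subseteq> vars G \<times> vars G \<and> acyclic (edges G) \<and>
     (\<forall>X\<in>vars G. finite (D X) \<and> D X \<noteq> {})"

definition parents :: "'v cgraph \<Rightarrow> 'v \<Rightarrow> 'v set" where
  "parents G X = {Y. (Y, X) \<in> edges G}"

definition observed_roots :: "'v cgraph \<Rightarrow> 'v set" where
  "observed_roots G = {X \<in> obs G. parents G X = {}}"

definition ctrl_parents :: "'v cgraph \<Rightarrow> 'v set \<Rightarrow> 'v \<Rightarrow> 'v set" where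
  "ctrl_parents G C X = parents G X \<inter> C"

section \<open>Structural equation models\<close>

text \<open>\<open>fn M X p e\<close> is the value of \<open>X\<close> when its parents have the values \<open>p\<close> and its noise
  variable the value \<open>e\<close>. The noise variables are discrete, and \<open>noise M X\<close> is the distribution
  of the one of \<open>X\<close>; since they are jointly independent, their joint distribution is a product.\<close>

record ('v, 'a) sem =
  fn :: "'v \<Rightarrow> ('v \<Rightarrow> 'a) \<Rightarrow> nat \<Rightarrow> 'a"
  noise :: "'v \<Rightarrow> nat pmf"

definition is_sem :: "('v \<Rightarrow> 'a set) \<Rightarrow> 'v cgraph \<Rightarrow> ('v, 'a) sem \<Rightarrow> bool" where
  "is_sem D G M \<longleftrightarrow>
     (\<forall>X\<in>vars G. \<forall>p\<in>Pi\<^sub>E (parents G X) D. \<forall>e. fn M X p e \<in> D X)"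

text \<open>The structural equations of an acyclic graph have exactly one solution for each value of
  the noise.\<close>

definition solution :: "'v cgraph \<Rightarrow> ('v, 'a) sem \<Rightarrow> ('v \<Rightarrow> nat) \<Rightarrow> 'v \<Rightarrow> 'a" where
  "solution G M \<epsilon> =
     (THE v. v \<in> extensional (vars G) \<and>
             (\<forall>X\<in>vars G. v X = fn M X (restrict v (parents G X)) (\<epsilon> X)))"

definition joint_law :: "'v cgraph \<Rightarrow> ('v, 'a) sem \<Rightarrow> ('v \<Rightarrow> 'a) pmf" where
  "joint_law G M = map_pmf (solution G M) (Pi_pmf (vars G) 0 (noise M))"

definition obs_law :: "'v cgraph \<Rightarrow> ('v, 'a) sem \<Rightarrow> ('v \<Rightarrow> 'a) \<Rightarrow> real" where
  "obs_law G M n = measure_pmf.prob (joint_law G M) {v. restrict v (obs G) = n}"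

definition do_sem :: "'v set \<Rightarrow> ('v \<Rightarrow> 'a) \<Rightarrow> ('v, 'a) sem \<Rightarrow> ('v, 'a) sem" where
  "do_sem T t M = M\<lparr>fn := (\<lambda>X. if X \<in> T then (\<lambda>_ _. t X) else fn M X)\<rparr>"

definition causal_effect ::
  "'v cgraph \<Rightarrow> ('v, 'a) sem \<Rightarrow> 'v set \<Rightarrow> 'v set \<Rightarrow> ('v \<Rightarrow> 'a) \<Rightarrow> ('v \<Rightarrow> 'a) \<Rightarrow> real" where
  "causal_effect G M T S t s =
     measure_pmf.prob (joint_law G (do_sem T t M)) {v. restrict v S = s}"

definition positive_sem :: "('v \<Rightarrow> 'a set) \<Rightarrow> 'v cgraph \<Rightarrow> ('v, 'a) sem \<Rightarrow> bool" where
  "positive_sem D G M \<longleftrightarrow> (\<forall>n\<in>Pi\<^sub>E (obs G) D. obs_law G M n > 0)"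

section \<open>Labels\<close>

text \<open>Only the values of \<open>L\<close> on \<open>Pi\<^sub>E C D\<close> matter. The conditional independence of \<open>X\<close> and \<open>Y\<close> in
  the context \<open>C = c\<close> for a label \<open>(Y, X) \<in> L c\<close> is not a separate condition: it holds in every
  compatible model (given the other parents of \<open>X\<close>), and only those models are considered below.\<close>

definition label_set ::
  "('v \<Rightarrow> 'a set) \<Rightarrow> 'v cgraph \<Rightarrow> 'v set \<Rightarrow> (('v \<Rightarrow> 'a) \<Rightarrow> ('v \<times> 'v) set) \<Rightarrow> bool" where
  "label_set D G C L \<longleftrightarrow>
     (\<forall>c\<in>Pi\<^sub>E C D. \<forall>(Y, X)\<in>L c. (Y, X) \<in> edges G \<and> X \<notin> C \<and> Y \<notin> C)"

definition compatible ::
  "('v \<Rightarrow> 'a set) \<Rightarrow> 'v cgraph \<Rightarrow> 'v set \<Rightarrow> (('v \<Rightarrow> 'a) \<Rightarrow> ('v \<times> 'v) set) \<Rightarrow> ('v, 'a) sem \<Rightarrow> bool"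
  where
  "compatible D G C L M \<longleftrightarrow>
     (\<forall>c\<in>Pi\<^sub>E C D. \<forall>(Y, X)\<in>L c.
        \<forall>p\<in>Pi\<^sub>E (parents G X) D. \<forall>q\<in>Pi\<^sub>E (parents G X) D.
          (\<forall>Z\<in>ctrl_parents G C X. p Z = c Z \<and> q Z = c Z) \<and>
          (\<forall>Z\<in>parents G X - {Y}. p Z = q Z)
          \<longrightarrow> (\<forall>e. fn M X p e = fn M X q e))"

section \<open>Identifiability\<close>

text \<open>A distribution of the variables \<open>A\<close> is given by its mass function, which vanishes outside
  \<open>Pi\<^sub>E A D\<close>. On these functions the product topology is the Euclidean one.\<close>

definition distributions :: "('v \<Rightarrow> 'a set) \<Rightarrow> 'v set \<Rightarrow> (('v \<Rightarrow> 'a) \<Rightarrow> real) set" where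
  "distributions D A =
     {P. (\<forall>n. P n \<ge> 0) \<and> (\<forall>n. n \<notin> Pi\<^sub>E A D \<longrightarrow> P n = 0) \<and> (\<Sum>n\<in>Pi\<^sub>E A D. P n) = 1}"

definition positive_distributions :: "('v \<Rightarrow> 'a set) \<Rightarrow> 'v set \<Rightarrow> (('v \<Rightarrow> 'a) \<Rightarrow> real) set" where
  "positive_distributions D A = {P \<in> distributions D A. \<forall>n\<in>Pi\<^sub>E A D. P n > 0}"

definition context_prob ::
  "('v \<Rightarrow> 'a set) \<Rightarrow> 'v set \<Rightarrow> 'v set \<Rightarrow> ('v \<Rightarrow> 'a) \<Rightarrow> (('v \<Rightarrow> 'a) \<Rightarrow> real) \<Rightarrow> real" where
  "context_prob D A C c P = (\<Sum>n\<in>{n \<in> Pi\<^sub>E A D. restrict n C = c}. P n)"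

definition context_law ::
  "('v \<Rightarrow> 'a set) \<Rightarrow> 'v set \<Rightarrow> 'v set \<Rightarrow> ('v \<Rightarrow> 'a) \<Rightarrow> (('v \<Rightarrow> 'a) \<Rightarrow> real) \<Rightarrow> ('v \<Rightarrow> 'a) \<Rightarrow> real" where
  "context_law D A C c P n' =
     (\<Sum>n\<in>{n \<in> Pi\<^sub>E A D. restrict n C = c \<and> restrict n (A - C) = n'}. P n) / context_prob D A C c P"

definition identifiable_dag ::
  "('v \<Rightarrow> 'a set) \<Rightarrow> 'v cgraph \<Rightarrow> 'v set \<Rightarrow> 'v set \<Rightarrow> bool" where
  "identifiable_dag D G T S \<longleftrightarrow>
     (\<forall>t\<in>Pi\<^sub>E T D. \<forall>s\<in>Pi\<^sub>E S D. \<exists>F :: (('v \<Rightarrow> 'a) \<Rightarrow> real) \<Rightarrow> real.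
        continuous_on (positive_distributions D (obs G)) F \<and>
        (\<forall>M. is_sem D G M \<and> positive_sem D G M
             \<longrightarrow> F (obs_law G M) = causal_effect G M T S t s))"

text \<open>With labels, the operator has to be continuous on the distributions that are positive in
  every context \<open>c\<close> of positive probability; for \<open>C = {}\<close> these are the positive distributions. A
  context of probability \<open>0\<close> contributes nothing to a sum over the contexts, weighted with their
  probabilities, as the algorithm returns it. The choice of this domain matters for completeness.
  Let \<open>X \<rightarrow> Y\<close> be confounded by an unobserved \<open>U\<close>, let \<open>C \<rightarrow> X\<close>, all of them
  binary, and let \<open>(U, X)\<close> be a label for \<open>C = 1\<close> only. Then the effect of \<open>X\<close> on \<open>Y\<close> is \<open>P(y | x, C = 1)\<close>, which is
  continuous on the positive distributions, although the effect is not identifiable from the graph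
  for \<open>C = 0\<close>. Continuity on all distributions, on the other hand, is too much to ask: it fails
  for \<open>P(y | x)\<close>, the effect of \<open>X\<close> on \<open>Y\<close> in the graph \<open>X \<rightarrow> Y\<close>.\<close>

definition contextwise_positive_distributions ::
  "('v \<Rightarrow> 'a set) \<Rightarrow> 'v set \<Rightarrow> 'v set \<Rightarrow> (('v \<Rightarrow> 'a) \<Rightarrow> real) set" where
  "contextwise_positive_distributions D A C =
     {P \<in> distributions D A.
        \<forall>c\<in>Pi\<^sub>E C D. context_prob D A C c P > 0 \<longrightarrow>
          (\<forall>n\<in>Pi\<^sub>E A D. restrict n C = c \<longrightarrow> P n > 0)}"

lemma contextwise_positive_distributions_empty:
  "contextwise_positive_distributions D A {} = positive_distributions D A"
proof -
  have "context_prob D A {} (\<lambda>_. undefined) P = (\<Sum>n\<in>Pi\<^sub>E A D. P n)" for P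
    by (simp add: context_prob_def restrict_def)
  then show ?thesis
    by (auto simp: contextwise_positive_distributions_def positive_distributions_def
        distributions_def restrict_def)
qed

definition identifiable ::
  "('v \<Rightarrow> 'a set) \<Rightarrow> 'v cgraph \<Rightarrow> 'v set \<Rightarrow> (('v \<Rightarrow> 'a) \<Rightarrow> ('v \<times> 'v) set) \<Rightarrow>
   'v set \<Rightarrow> 'v set \<Rightarrow> bool" where
  "identifiable D G C L T S \<longleftrightarrow>
     (\<forall>t\<in>Pi\<^sub>E T D. \<forall>s\<in>Pi\<^sub>E S D. \<exists>F :: (('v \<Rightarrow> 'a) \<Rightarrow> real) \<Rightarrow> real.
        continuous_on (contextwise_positive_distributions D (obs G) C) F \<and>
        (\<forall>M. is_sem D G M \<and> compatible D G C L M \<and> positive_sem D G M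
             \<longrightarrow> F (obs_law G M) = causal_effect G M T S t s))"

section \<open>The algorithm\<close>

text \<open>A formula for \<open>P\<^sub>t(S)\<close> is represented by the map that takes the distribution \<open>P\<close> and the
  values \<open>t\<close> and \<open>s\<close> to its value.\<close>

type_synonym ('v, 'a) formula = "(('v \<Rightarrow> 'a) \<Rightarrow> real) \<Rightarrow> ('v \<Rightarrow> 'a) \<Rightarrow> ('v \<Rightarrow> 'a) \<Rightarrow> real"

datatype ('v, 'a) answer = Non_Identifiable | Formula (the_formula: "('v, 'a) formula")

definition sound_complete_dag_procedure ::
  "('v \<Rightarrow> 'a set) \<Rightarrow> ('v cgraph \<Rightarrow> 'v set \<Rightarrow> 'v set \<Rightarrow> ('v, 'a) answer) \<Rightarrow> bool" where
  "sound_complete_dag_procedure D idp \<longleftrightarrow>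
     (\<forall>G T S. causal_dag D G \<and> T \<subseteq> obs G \<and> S \<subseteq> obs G \<and> T \<inter> S = {} \<longrightarrow>
        (\<forall>F. idp G T S = Formula F \<longrightarrow>
           identifiable_dag D G T S \<and>
           (\<forall>M. is_sem D G M \<and> positive_sem D G M \<longrightarrow>
              (\<forall>t\<in>Pi\<^sub>E T D. \<forall>s\<in>Pi\<^sub>E S D. F (obs_law G M) t s = causal_effect G M T S t s))) \<and>
        (idp G T S = Non_Identifiable \<longrightarrow> \<not> identifiable_dag D G T S))"

definition deletable ::
  "('v \<Rightarrow> 'a set) \<Rightarrow> 'v set \<Rightarrow> 'v cgraph \<times> (('v \<Rightarrow> 'a) \<Rightarrow> ('v \<times> 'v) set) \<Rightarrow> 'v \<times> 'v \<Rightarrow> bool" where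
  "deletable D C = (\<lambda>(G, L) (Y, X). (\<exists>c\<in>Pi\<^sub>E C D. (Y, X) \<in> L c) \<and> ctrl_parents G C X = {})"

definition delete_edge ::
  "'v cgraph \<times> (('v \<Rightarrow> 'a) \<Rightarrow> ('v \<times> 'v) set) \<Rightarrow> 'v \<times> 'v \<Rightarrow>
   'v cgraph \<times> (('v \<Rightarrow> 'a) \<Rightarrow> ('v \<times> 'v) set)" where
  "delete_edge = (\<lambda>(G, L) e. (G\<lparr>edges := edges G - {e}\<rparr>, \<lambda>c. L c - {e}))"

definition prune ::
  "('v \<Rightarrow> 'a set) \<Rightarrow> 'v set \<Rightarrow> 'v cgraph \<times> (('v \<Rightarrow> 'a) \<Rightarrow> ('v \<times> 'v) set) \<Rightarrow>
   'v cgraph \<times> (('v \<Rightarrow> 'a) \<Rightarrow> ('v \<times> 'v) set)" where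
  "prune D C =
     while (\<lambda>\<sigma>. \<exists>e. deletable D C \<sigma> e) (\<lambda>\<sigma>. delete_edge \<sigma> (SOME e. deletable D C \<sigma> e))"

definition addable ::
  "('v \<Rightarrow> 'a set) \<Rightarrow> 'v cgraph \<Rightarrow> 'v set \<Rightarrow> (('v \<Rightarrow> 'a) \<Rightarrow> ('v \<times> 'v) set) \<Rightarrow>
   ('v \<Rightarrow> 'a) \<times> ('v \<times> 'v) \<Rightarrow> bool" where
  "addable D G C L = (\<lambda>(c\<^sub>2, (Y, X)).
     c\<^sub>2 \<in> Pi\<^sub>E C D \<and> (Y, X) \<notin> L c\<^sub>2 \<and>
     (\<exists>c\<^sub>1\<in>Pi\<^sub>E C D. (Y, X) \<in> L c\<^sub>1 \<and>
        restrict c\<^sub>1 (ctrl_parents G C X) = restrict c\<^sub>2 (ctrl_parents G C X)))"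

definition add_label ::
  "(('v \<Rightarrow> 'a) \<Rightarrow> ('v \<times> 'v) set) \<Rightarrow> ('v \<Rightarrow> 'a) \<times> ('v \<times> 'v) \<Rightarrow>
   (('v \<Rightarrow> 'a) \<Rightarrow> ('v \<times> 'v) set)" where
  "add_label L = (\<lambda>(c, e). L(c := insert e (L c)))"

definition saturate ::
  "('v \<Rightarrow> 'a set) \<Rightarrow> 'v cgraph \<Rightarrow> 'v set \<Rightarrow> (('v \<Rightarrow> 'a) \<Rightarrow> ('v \<times> 'v) set) \<Rightarrow>
   (('v \<Rightarrow> 'a) \<Rightarrow> ('v \<times> 'v) set)" where
  "saturate D G C =
     while (\<lambda>L. \<exists>ce. addable D G C L ce) (\<lambda>L. add_label L (SOME ce. addable D G C L ce))"

definition context_graph ::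
  "'v cgraph \<Rightarrow> 'v set \<Rightarrow> (('v \<Rightarrow> 'a) \<Rightarrow> ('v \<times> 'v) set) \<Rightarrow> ('v \<Rightarrow> 'a) \<Rightarrow> 'v cgraph" where
  "context_graph G C L c =
     \<lparr>vars = vars G - C, obs = obs G - C,
      edges = edges G \<inter> ((vars G - C) \<times> (vars G - C)) - L c\<rparr>"

definition algorithm ::
  "('v \<Rightarrow> 'a set) \<Rightarrow> ('v cgraph \<Rightarrow> 'v set \<Rightarrow> 'v set \<Rightarrow> ('v, 'a) answer) \<Rightarrow>
   'v cgraph \<Rightarrow> 'v set \<Rightarrow> (('v \<Rightarrow> 'a) \<Rightarrow> ('v \<times> 'v) set) \<Rightarrow> 'v set \<Rightarrow> 'v set \<Rightarrow> ('v, 'a) answer" where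
  "algorithm D idp G C L T S =
     (let (G\<^sub>1, L\<^sub>1) = prune D C (G, L);
          L\<^sub>2 = saturate D G\<^sub>1 C L\<^sub>1;
          ans = (\<lambda>c. idp (context_graph G\<^sub>1 C L\<^sub>2 c) T S)
      in if \<exists>c\<in>Pi\<^sub>E C D. ans c = Non_Identifiable then Non_Identifiable
         else Formula (\<lambda>P t s. \<Sum>c\<in>Pi\<^sub>E C D.
                the_formula (ans c) (context_law D (obs G) C c P) t s * context_prob D (obs G) C c P))"

end

(*
The control variables have no parents, so conditioning on C = c leaves the noise of the other
variables untouched: given C = c, a compatible model is a model M_c of the graph G_c of the
algorithm, and both the observed law and the causal effect are mixtures over c of those of M_c
with the weights P(c). This gives the returned formula. It is continuous also where P(c) = 0
because the operators for the G_c can be truncated to [0, 1].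

Conversely, let c be a context and M' a positive model of G_c. Let every variable whose control
parents agree with c follow M', let all the other variables be pure noise, and let C = c with
probability tending to 1. Saturation of the labels makes these models compatible; they are
positive, and their observed laws tend to the law of M' placed on C = c, where an operator that
identifies the effect from the labelled graph is continuous. So it identifies the effect from G_c.
*)
theory Submission
  imports Defs "HOL-Real_Asymp.Real_Asymp"
begin

section \<open>Solutions of the structural equations\<close>

text \<open>Positivity shapes the converse. Fixing \<open>C = c\<close> outright violates it as soon
  as there is another context, so an operator is not known to be correct on such a law; its value
  there is reached only by continuity, along positive models. What these models do in the other
  contexts is irrelevant: it weighs at most \<open>1 - P(c)\<close>, and all quantities involved are
  bounded by 1. The same bound explains the truncation in the forward direction. An operator for
  \<open>G_c\<close> is known to be correct on laws of models only and may be unbounded as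
  \<open>P(c)\<close> tends to 0, whereas a bounded one is damped by the factor \<open>P(c)\<close>.
  Both directions use one description of \<open>G_c\<close> by the original labels: an edge into
  \<open>X\<close> is lost iff it starts or ends in \<open>C\<close> or some context that agrees
  with \<open>c\<close> on the control parents of \<open>X\<close> labels it. Forwards, such a label
  allows an argument of a structural equation to be changed; backwards, it is exactly the case in
  which the constructed equation has to ignore that argument.\<close>

lemma causal_dag_wf:
  assumes "causal_dag D G"
  shows "wf (edges G)"
proof (rule finite_acyclic_wf)
  show "finite (edges G)"
    using assms finite_subset[of "edges G" "vars G \<times> vars G"] by (simp add: causal_dag_def)
  show "acyclic (edges G)"
    using assms by (simp add: causal_dag_def)
qed

lemma parents_subset_vars: "causal_dag D G \<Longrightarrow> parents G X \<subseteq> vars G"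
  by (auto simp: causal_dag_def parents_def)

lemma structural_equations_unique:
  assumes dag: "causal_dag D G"
    and v: "v \<in> extensional (vars G)"
      "\<And>X. X \<in> vars G \<Longrightarrow> v X = fn M X (restrict v (parents G X)) (\<epsilon> X)"
    and w: "w \<in> extensional (vars G)"
      "\<And>X. X \<in> vars G \<Longrightarrow> w X = fn M X (restrict w (parents G X)) (\<epsilon> X)"
  shows "v = w"
proof
  fix X
  show "v X = w X"
  proof (induction X rule: wf_induct_rule[OF causal_dag_wf[OF dag]])
    case (1 X)
    show ?case
    proof (cases "X \<in> vars G")
      case True
      have "restrict v (parents G X) = restrict w (parents G X)"
        using 1 by (auto simp: parents_def)
      then show ?thesis using True v(2) w(2) by simp
    next
      case False
      then show ?thesis using v(1) w(1) by (simp add: extensional_def)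
    qed
  qed
qed

lemma structural_equations_solvable:
  assumes dag: "causal_dag D G"
  shows "\<exists>v. v \<in> extensional (vars G) \<and>
    (\<forall>X\<in>vars G. v X = fn M X (restrict v (parents G X)) (\<epsilon> X))"
proof -
  define v where "v = wfrec (edges G)
    (\<lambda>v X. if X \<in> vars G then fn M X (restrict v (parents G X)) (\<epsilon> X) else undefined)"
  have v: "v X = (if X \<in> vars G then fn M X (restrict v (parents G X)) (\<epsilon> X) else undefined)" for X
  proof -
    \<comment> \<open>The recursion may look up predecessors only; the equation of \<open>X\<close>
      reads nothing but its parents, so the cut is invisible.\<close>
    have "restrict (cut v (edges G) X) (parents G X) = restrict v (parents G X)"
      by (auto simp: parents_def cut_apply)
    then show ?thesis
      by (subst def_wfrec[OF eq_reflection[OF v_def] causal_dag_wf[OF dag]]) simp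
  qed
  have "v \<in> extensional (vars G)" by (simp add: extensional_def v)
  moreover have "\<forall>X\<in>vars G. v X = fn M X (restrict v (parents G X)) (\<epsilon> X)"
  proof
    fix X assume "X \<in> vars G"
    then show "v X = fn M X (restrict v (parents G X)) (\<epsilon> X)"
      using v[of X] by simp
  qed
  ultimately show ?thesis by blast
qed

lemma solution_eqI:
  assumes "causal_dag D G" "v \<in> extensional (vars G)"
    "\<And>X. X \<in> vars G \<Longrightarrow> v X = fn M X (restrict v (parents G X)) (\<epsilon> X)"
  shows "solution G M \<epsilon> = v"
  unfolding solution_def
proof (rule the_equality)
  fix w
  assume w: "w \<in> extensional (vars G) \<and>
    (\<forall>X\<in>vars G. w X = fn M X (restrict w (parents G X)) (\<epsilon> X))"
  show "w = v"
    by (rule structural_equations_unique[OF assms(1) _ _ assms(2,3)]) (simp_all add: w)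
qed (simp add: assms)

lemma
  assumes "causal_dag D G"
  shows solution_extensional: "solution G M \<epsilon> \<in> extensional (vars G)"
    and solution_equation:
      "X \<in> vars G \<Longrightarrow> solution G M \<epsilon> X = fn M X (restrict (solution G M \<epsilon>) (parents G X)) (\<epsilon> X)"
proof -
  obtain v where v: "v \<in> extensional (vars G)"
      "\<forall>X\<in>vars G. v X = fn M X (restrict v (parents G X)) (\<epsilon> X)"
    using structural_equations_solvable[OF assms] by blast
  then have "solution G M \<epsilon> = v" by (intro solution_eqI[OF assms]) auto
  with v show "solution G M \<epsilon> \<in> extensional (vars G)"
    and "X \<in> vars G \<Longrightarrow> solution G M \<epsilon> X = fn M X (restrict (solution G M \<epsilon>) (parents G X)) (\<epsilon> X)"
    by auto
qed

lemma solution_in_domain: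
  assumes dag: "causal_dag D G" and sem: "is_sem D G M"
  shows "solution G M \<epsilon> \<in> Pi\<^sub>E (vars G) D"
proof -
  have "X \<in> vars G \<longrightarrow> solution G M \<epsilon> X \<in> D X" for X
  proof (induction X rule: wf_induct_rule[OF causal_dag_wf[OF dag]])
    case (1 X)
    have "restrict (solution G M \<epsilon>) (parents G X) \<in> Pi\<^sub>E (parents G X) D"
      using 1 parents_subset_vars[OF dag] by (auto simp: parents_def)
    then show ?case
      using sem by (simp add: solution_equation[OF dag] is_sem_def)
  qed
  then show ?thesis using solution_extensional[OF dag] by (auto simp: PiE_def)
qed

text \<open>The noise values \<open>a\<close> and \<open>b\<close> may differ, so this also compares
  models that encode their noise differently. Extensional \<open>p\<close> suffice because the
  equations feed only restrictions to \<open>fn\<close>.\<close>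

lemma solution_cong:
  assumes dag: "causal_dag D G"
    and "\<And>X p. X \<in> vars G \<Longrightarrow> p \<in> extensional (parents G X) \<Longrightarrow> fn M X p (a X) = fn M' X p (b X)"
  shows "solution G M a = solution G M' b"
proof (rule solution_eqI[OF dag solution_extensional[OF dag]])
  fix X assume X: "X \<in> vars G"
  show "solution G M' b X = fn M X (restrict (solution G M' b) (parents G X)) (a X)"
    by (subst solution_equation[OF dag X]) (rule assms(2)[OF X restrict_extensional, symmetric])
qed

lemma solution_noise_cong:
  "causal_dag D G \<Longrightarrow> (\<And>X. X \<in> vars G \<Longrightarrow> a X = b X) \<Longrightarrow> solution G M a = solution G M b"
  by (rule solution_cong) auto

text \<open>A function applied to each noise variable keeps them independent, so noise may carry
  extra information that \<open>g\<close> forgets. \<open>g 0 = 0\<close> preserves the default that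
  \<open>Pi_pmf\<close> assigns outside the graph.\<close>

lemma joint_law_reparametrize:
  assumes dag: "causal_dag D G"
    and noise: "\<And>X. X \<in> vars G \<Longrightarrow> noise M' X = map_pmf g (noise M X)"
    and fn: "\<And>X p e. X \<in> vars G \<Longrightarrow> p \<in> extensional (parents G X) \<Longrightarrow> fn M X p e = fn M' X p (g e)"
    and g0: "g 0 = 0"
  shows "joint_law G M = joint_law G M'"
proof -
  have fin: "finite (vars G)" using dag by (simp add: causal_dag_def)
  have "Pi_pmf (vars G) 0 (noise M') = Pi_pmf (vars G) 0 (\<lambda>X. map_pmf g (noise M X))"
    by (intro Pi_pmf_cong) (auto simp: noise)
  also have "\<dots> = map_pmf (\<lambda>h. g \<circ> h) (Pi_pmf (vars G) 0 (noise M))"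
    by (rule Pi_pmf_map[where f = g, OF fin g0])
  finally have "joint_law G M' = map_pmf (\<lambda>h. solution G M' (g \<circ> h)) (Pi_pmf (vars G) 0 (noise M))"
    by (simp add: joint_law_def map_pmf_comp)
  also have "(\<lambda>h. solution G M' (g \<circ> h)) = solution G M"
    by (intro ext solution_cong[OF dag, symmetric]) (simp add: fn)
  finally show ?thesis by (simp add: joint_law_def)
qed

lemma joint_law_support:
  assumes "causal_dag D G" "is_sem D G M" "v \<in> set_pmf (joint_law G M)"
  shows "v \<in> Pi\<^sub>E (vars G) D"
proof -
  obtain \<epsilon> where "v = solution G M \<epsilon>"
    using assms(3) by (auto simp: joint_law_def)
  then show ?thesis
    using solution_in_domain[OF assms(1,2)] by simp
qed

section \<open>Interventions and compatibility\<close>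

lemma is_sem_do:
  assumes "is_sem D G M" "t \<in> Pi\<^sub>E T D"
  shows "is_sem D G (do_sem T t M)"
  using assms by (auto simp: is_sem_def do_sem_def PiE_def Pi_def)

lemma compatibleD:
  assumes "compatible D G C L M" "c \<in> Pi\<^sub>E C D" "(Y, X) \<in> L c"
    "p \<in> Pi\<^sub>E (parents G X) D" "q \<in> Pi\<^sub>E (parents G X) D"
    "\<And>Z. Z \<in> ctrl_parents G C X \<Longrightarrow> p Z = c Z \<and> q Z = c Z"
    "\<And>Z. Z \<in> parents G X - {Y} \<Longrightarrow> p Z = q Z"
  shows "fn M X p e = fn M X q e"
proof -
  have "\<forall>p\<in>Pi\<^sub>E (parents G X) D. \<forall>q\<in>Pi\<^sub>E (parents G X) D.
      (\<forall>Z\<in>ctrl_parents G C X. p Z = c Z \<and> q Z = c Z) \<and> (\<forall>Z\<in>parents G X - {Y}. p Z = q Z)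
      \<longrightarrow> (\<forall>e. fn M X p e = fn M X q e)"
    using bspec[OF bspec[OF assms(1)[unfolded compatible_def] assms(2)] assms(3)]
    by (simp only: prod.case)
  then show ?thesis using assms(4-) by blast
qed

lemma compatibleI:
  assumes "\<And>c Y X p q e. \<lbrakk>c \<in> Pi\<^sub>E C D; (Y, X) \<in> L c;
    p \<in> Pi\<^sub>E (parents G X) D; q \<in> Pi\<^sub>E (parents G X) D;
    \<And>Z. Z \<in> ctrl_parents G C X \<Longrightarrow> p Z = c Z \<and> q Z = c Z;
    \<And>Z. Z \<in> parents G X - {Y} \<Longrightarrow> p Z = q Z\<rbrakk> \<Longrightarrow> fn M X p e = fn M X q e"
  shows "compatible D G C L M"
  unfolding compatible_def
proof (intro ballI, rule case_prodI2, intro ballI impI allI, elim conjE)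
  fix c YX Y X p q e
  assume "c \<in> Pi\<^sub>E C D" "YX \<in> L c" "YX = (Y, X)"
    "p \<in> Pi\<^sub>E (parents G X) D" "q \<in> Pi\<^sub>E (parents G X) D"
    "\<forall>Z\<in>ctrl_parents G C X. p Z = c Z \<and> q Z = c Z" "\<forall>Z\<in>parents G X - {Y}. p Z = q Z"
  then show "fn M X p e = fn M X q e"
    by (intro assms[of c Y X]) (simp_all only: Ball_def)
qed

text \<open>Intervened functions are constant and all others unchanged. The factorization over
  contexts can therefore be applied to the intervened model as well.\<close>

lemma compatible_do:
  assumes "compatible D G C L M"
  shows "compatible D G C L (do_sem T t M)"
proof (rule compatibleI)
  fix c Y X p q e
  assume "c \<in> Pi\<^sub>E C D" "(Y, X) \<in> L c" "p \<in> Pi\<^sub>E (parents G X) D" "q \<in> Pi\<^sub>E (parents G X) D"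
    "\<And>Z. Z \<in> ctrl_parents G C X \<Longrightarrow> p Z = c Z \<and> q Z = c Z" "\<And>Z. Z \<in> parents G X - {Y} \<Longrightarrow> p Z = q Z"
  then have "fn M X p e = fn M X q e"
    by (rule compatibleD[OF assms])
  then show "fn (do_sem T t M) X p e = fn (do_sem T t M) X q e"
    by (simp add: do_sem_def)
qed

section \<open>Laws as finite sums over values\<close>

lemma measure_pmf_finite_partition:
  assumes "finite A" "\<And>x. x \<in> set_pmf p \<Longrightarrow> f x \<in> A"
  shows "(\<Sum>a\<in>A. measure_pmf.prob p {x. f x = a \<and> Q x}) = measure_pmf.prob p {x. Q x}"
proof -
  have "measure_pmf.prob p {x. Q x} = measure_pmf.prob p (\<Union>a\<in>A. {x. f x = a \<and> Q x})"
    by (rule measure_pmf.finite_measure_eq_AE) (auto simp: AE_measure_pmf_iff assms)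
  also have "\<dots> = (\<Sum>a\<in>A. measure_pmf.prob p {x. f x = a \<and> Q x})"
    by (rule measure_pmf.finite_measure_finite_Union) (auto simp: assms disjoint_family_on_def)
  finally show ?thesis by simp
qed

lemma obs_law_distribution:
  assumes dag: "causal_dag D G" and sem: "is_sem D G M"
  shows "obs_law G M \<in> distributions D (obs G)"
proof -
  have sub: "obs G \<subseteq> vars G" and fin: "finite (Pi\<^sub>E (obs G) D)"
    using dag by (auto simp: causal_dag_def intro!: finite_PiE intro: finite_subset)
  have supp: "restrict v (obs G) \<in> Pi\<^sub>E (obs G) D" if "v \<in> set_pmf (joint_law G M)" for v
    using joint_law_support[OF dag sem that] sub by auto
  have "obs_law G M n = 0" if "n \<notin> Pi\<^sub>E (obs G) D" for n
    unfolding obs_law_def measure_pmf_zero_iff using supp that by blast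
  moreover have "(\<Sum>n\<in>Pi\<^sub>E (obs G) D. obs_law G M n) = 1"
    using measure_pmf_finite_partition[OF fin supp, where Q = "\<lambda>_. True"]
    by (simp add: obs_law_def)
  ultimately show ?thesis
    by (simp add: distributions_def) (simp add: obs_law_def)
qed

section \<open>The output of the first two steps\<close>

text \<open>Closed form of \<open>G_c\<close> in terms of the original graph and labels. Agreement
  with \<open>c\<close> on the control parents of \<open>X\<close> accounts for the added labels; if
  there are no control parents, every context agrees, which accounts for the deleted edges.\<close>

definition residual_graph ::
  "('v \<Rightarrow> 'a set) \<Rightarrow> 'v cgraph \<Rightarrow> 'v set \<Rightarrow> (('v \<Rightarrow> 'a) \<Rightarrow> ('v \<times> 'v) set) \<Rightarrow> ('v \<Rightarrow> 'a) \<Rightarrow> 'v cgraph" where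
  "residual_graph D G C L c =
     \<lparr>vars = vars G - C, obs = obs G - C,
      edges = {(Y, X) \<in> edges G. Y \<notin> C \<and> X \<notin> C \<and>
        (\<forall>c'\<in>Pi\<^sub>E C D. restrict c' (ctrl_parents G C X) = restrict c (ctrl_parents G C X)
           \<longrightarrow> (Y, X) \<notin> L c')}\<rparr>"

locale labelled_dag =
  fixes D :: "'v \<Rightarrow> 'a set"
    and G :: "'v cgraph"
    and C :: "'v set"
    and L :: "('v \<Rightarrow> 'a) \<Rightarrow> ('v \<times> 'v) set"
  assumes dag: "causal_dag D G"
    and roots: "C \<subseteq> observed_roots G"
    and labels: "label_set D G C L"
begin

lemma finite_vars: "finite (vars G)"
  and finite_D: "X \<in> vars G \<Longrightarrow> finite (D X)"
  and nonempty_D: "X \<in> vars G \<Longrightarrow> D X \<noteq> {}"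
  and obs_vars: "obs G \<subseteq> vars G"
  and edges_vars: "edges G \<subseteq> vars G \<times> vars G"
  and C_obs: "C \<subseteq> obs G"
  and parents_C: "X \<in> C \<Longrightarrow> parents G X = {}"
  using dag roots by (auto simp: causal_dag_def observed_roots_def)

lemma C_vars: "C \<subseteq> vars G"
  using C_obs obs_vars by blast

lemma finite_domain: "A \<subseteq> vars G \<Longrightarrow> finite (Pi\<^sub>E A D)"
  using finite_vars by (intro finite_PiE finite_D) (auto intro: finite_subset)

lemma finite_edges: "finite (edges G)"
  using edges_vars finite_vars by (meson finite_SigmaI finite_subset)

lemma labelD:
  assumes "c \<in> Pi\<^sub>E C D" "(Y, X) \<in> L c"
  shows "(Y, X) \<in> edges G" "X \<notin> C" "Y \<notin> C"
  using assms labels by (auto simp: label_set_def)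

definition unconditional_labels :: "('v \<times> 'v) set" where
  "unconditional_labels = {(Y, X). (\<exists>c\<in>Pi\<^sub>E C D. (Y, X) \<in> L c) \<and> ctrl_parents G C X = {}}"

text \<open>Labelled edges never start in \<open>C\<close>, so deletions leave all control parents
  alone. Hence no deletion affects the deletability of another edge, and the result does not depend
  on the order.\<close>

lemma ctrl_parents_delete:
  assumes "R \<subseteq> unconditional_labels"
  shows "ctrl_parents (G\<lparr>edges := edges G - R\<rparr>) C X = ctrl_parents G C X"
  using assms labelD(3) by (fastforce simp: ctrl_parents_def parents_def unconditional_labels_def)

lemma prune_eq:
  "prune D C (G, L) =
     (G\<lparr>edges := edges G - unconditional_labels\<rparr>, \<lambda>c. L c - unconditional_labels)"
  unfolding prune_def
proof (rule while_rule[where r = "Wellfounded.measure (\<lambda>\<sigma>. card (edges (fst \<sigma>)))" and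
      P = "\<lambda>\<sigma>. \<exists>R\<subseteq>unconditional_labels. \<sigma> = (G\<lparr>edges := edges G - R\<rparr>, \<lambda>c. L c - R)"])
  show "\<exists>R\<subseteq>unconditional_labels. (G, L) = (G\<lparr>edges := edges G - R\<rparr>, \<lambda>c. L c - R)"
    by (rule exI[of _ "{}"]) simp
next
  fix \<sigma>
  assume "\<exists>R\<subseteq>unconditional_labels. \<sigma> = (G\<lparr>edges := edges G - R\<rparr>, \<lambda>c. L c - R)"
  then obtain R where R: "R \<subseteq> unconditional_labels" "\<sigma> = (G\<lparr>edges := edges G - R\<rparr>, \<lambda>c. L c - R)"
    by blast
  \<comment> \<open>What remains deletable is exactly what has not yet been deleted, so the loop can
    only stop at \<open>R = unconditional_labels\<close>.\<close>
  have del: "deletable D C \<sigma> e \<longleftrightarrow> e \<in> unconditional_labels - R" for e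
    by (cases e) (auto simp: R(2) deletable_def ctrl_parents_delete[OF R(1)] unconditional_labels_def)
  {
    assume "\<exists>e. deletable D C \<sigma> e"
    then have e: "(SOME e. deletable D C \<sigma> e) \<in> unconditional_labels - R" (is "?e \<in> _")
      using someI_ex[of "deletable D C \<sigma>"] del by blast
    have step: "delete_edge \<sigma> ?e =
        (G\<lparr>edges := edges G - insert ?e R\<rparr>, \<lambda>c. L c - insert ?e R)"
      by (simp add: delete_edge_def R(2) Diff_insert[symmetric])
    then show "\<exists>R\<subseteq>unconditional_labels.
        delete_edge \<sigma> ?e = (G\<lparr>edges := edges G - R\<rparr>, \<lambda>c. L c - R)"
      using e R(1) by (intro exI[of _ "insert ?e R"]) auto
    have "?e \<in> edges G - R"
      using e labelD(1) by (auto simp: unconditional_labels_def)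
    then have "card (edges G - insert ?e R) < card (edges G - R)"
      by (intro psubset_card_mono) (use finite_edges in auto)
    then show "(delete_edge \<sigma> ?e, \<sigma>) \<in> Wellfounded.measure (\<lambda>\<sigma>. card (edges (fst \<sigma>)))"
      by (simp only: step in_measure) (simp add: R(2))
  }
  assume "\<not> (\<exists>e. deletable D C \<sigma> e)"
  then have "R = unconditional_labels" using del R(1) by blast
  then show "\<sigma> = (G\<lparr>edges := edges G - unconditional_labels\<rparr>, \<lambda>c. L c - unconditional_labels)"
    by (simp add: R(2))
qed simp

definition label_closure :: "('v \<Rightarrow> 'a) \<Rightarrow> ('v \<times> 'v) set" where
  "label_closure c = {(Y, X). \<exists>c'\<in>Pi\<^sub>E C D. (Y, X) \<in> L c' \<and>
     restrict c' (ctrl_parents G C X) = restrict c (ctrl_parents G C X)}"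

text \<open>Agreement on the control parents of \<open>X\<close> is an equivalence on contexts:
  additions never leave the closure, and a state without addable labels already contains it. Each
  addition lowers the number of unlabelled pairs in the finite set
  \<open>Pi\<^sub>E C D \<times> edges G\<close>.\<close>

lemma saturate_eq:
  assumes c: "c \<in> Pi\<^sub>E C D"
  shows "saturate D G C L c = label_closure c"
proof -
  let ?I = "\<lambda>L'. \<forall>c\<in>Pi\<^sub>E C D. L c \<subseteq> L' c \<and> L' c \<subseteq> label_closure c"
  let ?Q = "\<lambda>L'. \<forall>c\<in>Pi\<^sub>E C D. L' c = label_closure c"
  let ?free = "\<lambda>L'. {(c, e). c \<in> Pi\<^sub>E C D \<and> e \<in> edges G \<and> e \<notin> L' c}"
  have fin: "finite (?free L')" for L'
    by (rule finite_subset[of _ "Pi\<^sub>E C D \<times> edges G"])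
      (use finite_domain[OF C_vars] finite_edges in auto)
  have "?Q (saturate D G C L)"
    unfolding saturate_def
  proof (rule while_rule[where r = "Wellfounded.measure (\<lambda>L'. card (?free L'))" and P = ?I])
    show "?I L" by (auto simp: label_closure_def)
  next
    fix L' assume I: "?I L'"
    {
      assume "\<exists>ce. addable D G C L' ce"
      then obtain c2 Y X where ce: "(SOME ce. addable D G C L' ce) = (c2, (Y, X))"
        and "addable D G C L' (c2, (Y, X))"
        using someI_ex[of "addable D G C L'"] by (metis surj_pair)
      then have c2: "c2 \<in> Pi\<^sub>E C D" "(Y, X) \<notin> L' c2"
        and "\<exists>c1\<in>Pi\<^sub>E C D. (Y, X) \<in> L' c1 \<and>
          restrict c1 (ctrl_parents G C X) = restrict c2 (ctrl_parents G C X)"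
        by (auto simp: addable_def)
      then obtain c1 where c1: "c1 \<in> Pi\<^sub>E C D" "(Y, X) \<in> label_closure c1"
          "restrict c1 (ctrl_parents G C X) = restrict c2 (ctrl_parents G C X)"
        using I by blast
      then have YX: "(Y, X) \<in> label_closure c2" by (simp add: label_closure_def)
      then show "?I (add_label L' (SOME ce. addable D G C L' ce))"
        unfolding ce using I by (auto simp: add_label_def)
      have "(Y, X) \<in> edges G" using YX labelD(1) by (auto simp: label_closure_def)
      then have "(c2, (Y, X)) \<in> ?free L' - ?free (add_label L' (c2, (Y, X)))"
        using c2 by (simp add: add_label_def)
      moreover have "?free (add_label L' (c2, (Y, X))) \<subseteq> ?free L'"
        by (auto simp: add_label_def split: if_splits)
      ultimately have "?free (add_label L' (c2, (Y, X))) \<subset> ?free L'"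
        by blast
      then show "(add_label L' (SOME ce. addable D G C L' ce), L')
          \<in> Wellfounded.measure (\<lambda>L'. card (?free L'))"
        unfolding ce by (simp add: psubset_card_mono[OF fin])
    }
    assume "\<not> (\<exists>ce. addable D G C L' ce)"
    then have na: "\<not> addable D G C L' (c, (Y, X))" for c Y X by blast
    have "label_closure c \<subseteq> L' c" if "c \<in> Pi\<^sub>E C D" for c
    proof clarify
      fix Y X assume "(Y, X) \<in> label_closure c"
      then obtain c1 where "c1 \<in> Pi\<^sub>E C D" "(Y, X) \<in> L c1"
          "restrict c1 (ctrl_parents G C X) = restrict c (ctrl_parents G C X)"
        by (auto simp: label_closure_def)
      moreover from this have "(Y, X) \<in> L' c1"
        using I by blast
      ultimately show "(Y, X) \<in> L' c"
        using that na[of c Y X] by (auto simp: addable_def)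
    qed
    then show "?Q L'" using I by blast
  qed simp
  then show ?thesis using c by blast
qed

lemma context_graph_eq:
  assumes c: "c \<in> Pi\<^sub>E C D" and pr: "prune D C (G, L) = (G\<^sub>1, L\<^sub>1)"
  shows "context_graph G\<^sub>1 C (saturate D G\<^sub>1 C L\<^sub>1) c = residual_graph D G C L c"
proof -
  have G1: "G\<^sub>1 = G\<lparr>edges := edges G - unconditional_labels\<rparr>"
    and L1: "L\<^sub>1 = (\<lambda>c. L c - unconditional_labels)"
    using pr by (simp_all add: prune_eq)
  have cp: "ctrl_parents G\<^sub>1 C X = ctrl_parents G C X" for X
    unfolding G1 by (rule ctrl_parents_delete) simp
  have L1_iff: "e \<in> L\<^sub>1 c \<longleftrightarrow> e \<in> L c \<and> e \<notin> unconditional_labels" for e c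
    by (simp add: L1)
  \<comment> \<open>Deletion keeps control variables parentless and labels on edges, so the
    description of saturation applies to the pruned data.\<close>
  interpret pruned: labelled_dag D G\<^sub>1 C L\<^sub>1
  proof
    show "causal_dag D G\<^sub>1"
      using dag acyclic_subset[of "edges G" "edges G - unconditional_labels"]
      by (auto simp: G1 causal_dag_def)
    show "C \<subseteq> observed_roots G\<^sub>1"
      using roots by (auto simp: G1 observed_roots_def parents_def)
    show "label_set D G\<^sub>1 C L\<^sub>1"
      using labels by (auto simp: G1 L1 label_set_def)
  qed
  have "(Y, X) \<in> edges G\<^sub>1 \<inter> ((vars G - C) \<times> (vars G - C)) - pruned.label_closure c
      \<longleftrightarrow> (Y, X) \<in> edges (residual_graph D G C L c)" for Y X
  \<comment> \<open>Without control parents, a labelled edge into \<open>X\<close> has been deleted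
    together with all its labels. With control parents, deletion has not touched
    \<open>(Y, X)\<close>, and saturation alone decides.\<close>
  proof (cases "ctrl_parents G C X = {}")
    case True
    then have U: "(Y, X) \<in> unconditional_labels \<longleftrightarrow> (\<exists>c\<in>Pi\<^sub>E C D. (Y, X) \<in> L c)"
      by (simp add: unconditional_labels_def)
    have "edges G\<^sub>1 = edges G - unconditional_labels" by (simp add: G1)
    moreover have "(Y, X) \<in> pruned.label_closure c \<longleftrightarrow>
        (\<exists>c\<in>Pi\<^sub>E C D. (Y, X) \<in> L c \<and> (Y, X) \<notin> unconditional_labels)"
      by (simp add: pruned.label_closure_def cp True L1_iff restrict_def)
    moreover have "(Y, X) \<in> edges (residual_graph D G C L c) \<longleftrightarrow>
        (Y, X) \<in> edges G \<and> Y \<notin> C \<and> X \<notin> C \<and> (\<forall>c'\<in>Pi\<^sub>E C D. (Y, X) \<notin> L c')"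
      by (simp add: residual_graph_def True restrict_def)
    ultimately show ?thesis
      using U edges_vars by blast
  next
    case False
    then have U: "(Y, X) \<notin> unconditional_labels"
      by (simp add: unconditional_labels_def)
    have "edges G\<^sub>1 = edges G - unconditional_labels" by (simp add: G1)
    moreover have "(Y, X) \<in> pruned.label_closure c \<longleftrightarrow> (\<exists>c'\<in>Pi\<^sub>E C D. (Y, X) \<in> L c' \<and>
        restrict c' (ctrl_parents G C X) = restrict c (ctrl_parents G C X))"
      using U by (simp add: pruned.label_closure_def cp L1_iff)
    moreover have "(Y, X) \<in> edges (residual_graph D G C L c) \<longleftrightarrow>
        (Y, X) \<in> edges G \<and> Y \<notin> C \<and> X \<notin> C \<and> (\<forall>c'\<in>Pi\<^sub>E C D.
          restrict c' (ctrl_parents G C X) = restrict c (ctrl_parents G C X) \<longrightarrow> (Y, X) \<notin> L c')"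
      by (simp add: residual_graph_def)
    ultimately show ?thesis
      using U edges_vars by blast
  qed
  then have "edges G\<^sub>1 \<inter> ((vars G - C) \<times> (vars G - C)) - pruned.label_closure c
      = edges (residual_graph D G C L c)"
    by (meson subset_antisym subrelI)
  moreover have "vars G\<^sub>1 = vars G" "obs G\<^sub>1 = obs G"
    by (simp_all add: G1)
  ultimately show ?thesis
    by (simp add: context_graph_def pruned.saturate_eq[OF c] residual_graph_def)
qed

end

section \<open>Product events and events of the observed variables\<close>

lemma measure_pair_pmf_times:
  "measure_pmf.prob (pair_pmf p q) (A \<times> B) = measure_pmf.prob p A * measure_pmf.prob q B"
proof -
  \<comment> \<open>Cutting both sets down to the supports makes them countable.\<close>
  have "measure_pmf.prob (pair_pmf p q) (A \<times> B)
      = measure_pmf.prob (pair_pmf p q) ((A \<inter> set_pmf p) \<times> (B \<inter> set_pmf q))"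
    by (rule measure_prob_cong_0) (auto simp: pmf_pair set_pmf_eq)
  also have "\<dots> = measure_pmf.prob p (A \<inter> set_pmf p) * measure_pmf.prob q (B \<inter> set_pmf q)"
    by (rule measure_pmf_prob_product) auto
  finally show ?thesis by (simp add: measure_Int_set_pmf)
qed

text \<open>Turns the sums that define \<open>context_prob\<close> and \<open>context_law\<close>
  into probabilities under the joint law.\<close>

lemma sum_obs_law:
  assumes dag: "causal_dag D G" and sem: "is_sem D G M"
  shows "(\<Sum>n\<in>{n \<in> Pi\<^sub>E (obs G) D. R n}. obs_law G M n)
    = measure_pmf.prob (joint_law G M) {v. R (restrict v (obs G))}"
proof -
  have sub: "obs G \<subseteq> vars G" and fin: "finite (Pi\<^sub>E (obs G) D)"
    using dag by (auto simp: causal_dag_def intro!: finite_PiE intro: finite_subset)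
  have supp: "restrict v (obs G) \<in> Pi\<^sub>E (obs G) D" if "v \<in> set_pmf (joint_law G M)" for v
    using joint_law_support[OF dag sem that] sub by auto
  have "{v. restrict v (obs G) = n \<and> R (restrict v (obs G))}
      = (if R n then {v. restrict v (obs G) = n} else {})" for n
    by auto
  then have "(\<Sum>n\<in>{n \<in> Pi\<^sub>E (obs G) D. R n}. obs_law G M n) = (\<Sum>n\<in>Pi\<^sub>E (obs G) D.
      measure_pmf.prob (joint_law G M) {v. restrict v (obs G) = n \<and> R (restrict v (obs G))})"
    by (simp add: sum.inter_filter[OF fin] obs_law_def if_distrib[of "measure_pmf.prob _"]
        cong: if_cong)
  also have "\<dots> = measure_pmf.prob (joint_law G M) {v. R (restrict v (obs G))}"
    by (rule measure_pmf_finite_partition[OF fin supp])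
  finally show ?thesis .
qed

section \<open>The model in a fixed context\<close>

context labelled_dag
begin

abbreviation residual :: "('v \<Rightarrow> 'a) \<Rightarrow> 'v cgraph" where
  "residual c \<equiv> residual_graph D G C L c"

lemma vars_residual [simp]: "vars (residual c) = vars G - C"
  and obs_residual [simp]: "obs (residual c) = obs G - C"
  by (simp_all add: residual_graph_def)

lemma causal_dag_residual: "causal_dag D (residual c)"
proof -
  have "edges (residual c) \<subseteq> edges G \<inter> ((vars G - C) \<times> (vars G - C))"
    using edges_vars by (auto simp: residual_graph_def)
  moreover from this have "acyclic (edges (residual c))"
    using dag acyclic_subset by (auto simp: causal_dag_def)
  ultimately show ?thesis
    using dag by (auto simp: causal_dag_def)
qed

lemma parents_residual: "parents (residual c) X \<subseteq> parents G X - C"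
  by (auto simp: residual_graph_def parents_def)

lemma parents_vars: "parents G X \<subseteq> vars G"
  using dag by (rule parents_subset_vars)

text \<open>In the context \<open>c\<close>, the parents of \<open>X\<close> that are removed in the residual graph can be given
  arbitrary values.\<close>

definition fill_parents :: "('v \<Rightarrow> 'a) \<Rightarrow> 'v \<Rightarrow> ('v \<Rightarrow> 'a) \<Rightarrow> 'v \<Rightarrow> 'a" where
  "fill_parents c X p = (\<lambda>Z\<in>parents G X.
     if Z \<in> C then c Z else if Z \<in> parents (residual c) X then p Z else (SOME a. a \<in> D Z))"

text \<open>The noise of \<open>M\<close> is kept, so that solutions in the whole graph and in the
  residual graph can be compared for each value of the noise.\<close>

definition context_sem :: "('v \<Rightarrow> 'a) \<Rightarrow> ('v, 'a) sem \<Rightarrow> ('v, 'a) sem" where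
  "context_sem c M = M\<lparr>fn := \<lambda>X p. fn M X (fill_parents c X p)\<rparr>"

lemma fill_parents_domain:
  assumes "c \<in> Pi\<^sub>E C D" "\<And>Z. Z \<in> parents (residual c) X \<Longrightarrow> p Z \<in> D Z"
  shows "fill_parents c X p \<in> Pi\<^sub>E (parents G X) D"
proof (rule PiE_I)
  fix Z assume Z: "Z \<in> parents G X"
  then have "D Z \<noteq> {}" using parents_vars nonempty_D by blast
  then show "fill_parents c X p Z \<in> D Z"
    using Z assms by (simp add: fill_parents_def some_in_eq PiE_mem[OF assms(1)])
qed (simp add: fill_parents_def)

lemma is_sem_context:
  assumes "is_sem D G M" "c \<in> Pi\<^sub>E C D"
  shows "is_sem D (residual c) (context_sem c M)"
  unfolding is_sem_def
proof (intro ballI allI)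
  fix X p e
  assume X: "X \<in> vars (residual c)" and p: "p \<in> Pi\<^sub>E (parents (residual c) X) D"
  have "fill_parents c X p \<in> Pi\<^sub>E (parents G X) D"
    by (rule fill_parents_domain[OF assms(2) PiE_mem[OF p]])
  then show "fn (context_sem c M) X p e \<in> D X"
    using assms(1) X by (simp add: is_sem_def context_sem_def)
qed

lemma context_sem_do: "context_sem c (do_sem T t M) = do_sem T t (context_sem c M)"
  by (rule sem.equality) (simp_all add: context_sem_def do_sem_def fun_eq_iff)

text \<open>Compatibility allows one labelled argument to change at a time, so \<open>q\<close> is
  reached from \<open>p\<close> by switching the removed parents one after another. The label that
  permits a switch may belong to another context \<open>c'\<close>, but that one agrees with
  \<open>c\<close> on the control parents of \<open>X\<close>, where \<open>p\<close> and
  \<open>q\<close> have the values of \<open>c\<close>.\<close>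

lemma fn_residual:
  assumes compat: "compatible D G C L M"
    and c: "c \<in> Pi\<^sub>E C D" and X: "X \<notin> C"
    and p: "p \<in> Pi\<^sub>E (parents G X) D" "\<And>Z. Z \<in> ctrl_parents G C X \<Longrightarrow> p Z = c Z"
    and q: "q \<in> Pi\<^sub>E (parents G X) D" "\<And>Z. Z \<in> ctrl_parents G C X \<Longrightarrow> q Z = c Z"
    and pq: "\<And>Z. Z \<in> parents (residual c) X \<Longrightarrow> p Z = q Z"
  shows "fn M X p e = fn M X q e"
proof -
  let ?R = "parents G X - C - parents (residual c) X"
  let ?mix = "\<lambda>B Z. if Z \<in> B then q Z else p Z"
  have mix: "?mix B \<in> Pi\<^sub>E (parents G X) D" if "B \<subseteq> parents G X" for B
    using p(1) q(1) that by (auto simp: PiE_def Pi_def extensional_def)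
  have step: "fn M X p e = fn M X (?mix B) e" if "finite B" "B \<subseteq> ?R" for B
    using that
  proof (induction B rule: finite_induct)
    case (insert Y B)
    have "(Y, X) \<in> edges G" "Y \<notin> C" "(Y, X) \<notin> edges (residual c)"
      using insert.prems by (auto simp: parents_def)
    then obtain c' where c': "c' \<in> Pi\<^sub>E C D" "(Y, X) \<in> L c'"
        "restrict c' (ctrl_parents G C X) = restrict c (ctrl_parents G C X)"
      using X by (auto simp: residual_graph_def)
    have "fn M X (?mix B) e = fn M X (?mix (insert Y B)) e"
    proof (rule compatibleD[OF compat c'(1,2)])
      fix Z assume Z: "Z \<in> ctrl_parents G C X"
      then have "c' Z = c Z" using c'(3) by (metis restrict_apply')
      then show "?mix B Z = c' Z \<and> ?mix (insert Y B) Z = c' Z"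
        using p(2)[OF Z] q(2)[OF Z] by auto
    next
      show "?mix B \<in> Pi\<^sub>E (parents G X) D" "?mix (insert Y B) \<in> Pi\<^sub>E (parents G X) D"
        using insert.prems by (blast intro!: mix)+
    qed simp
    then show ?case using insert by simp
  qed simp
  have fin: "finite ?R"
    using parents_vars finite_vars by (meson finite_Diff finite_subset)
  \<comment> \<open>Outside \<open>?R\<close> the assignments agree already: on control parents
    through \<open>c\<close>, on residual parents by \<open>pq\<close>, and off the parents both are
    undefined.\<close>
  have mix_R: "?mix ?R = q"
  proof
    fix Z show "?mix ?R Z = q Z"
    proof (cases "Z \<in> parents G X")
      case True
      then show ?thesis
        using p(2)[of Z] q(2)[of Z] pq[of Z] by (auto simp: ctrl_parents_def)
    next
      case False
      then show ?thesis
        using PiE_arb[OF p(1)] PiE_arb[OF q(1)] by simp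
    qed
  qed
  show ?thesis
    using step[OF fin subset_refl] unfolding mix_R .
qed

text \<open>Control variables have no parents, and \<open>\<lambda>_. undefined\<close> is the only
  extensional assignment to the empty set; so the context is a function of the noise of
  \<open>C\<close> alone.\<close>

definition context_of :: "('v, 'a) sem \<Rightarrow> ('v \<Rightarrow> nat) \<Rightarrow> 'v \<Rightarrow> 'a" where
  "context_of M \<epsilon> = (\<lambda>X\<in>C. fn M X (\<lambda>_. undefined) (\<epsilon> X))"

lemma solution_context: "restrict (solution G M \<epsilon>) C = context_of M \<epsilon>"
proof (unfold context_of_def, rule restrict_ext)
  fix X assume X: "X \<in> C"
  then have "X \<in> vars G" using C_vars by blast
  then show "solution G M \<epsilon> X = fn M X (\<lambda>_. undefined) (\<epsilon> X)"
    by (subst solution_equation[OF dag]) (simp_all add: parents_C[OF X] restrict_def)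
qed

lemma context_of_domain:
  assumes "is_sem D G M"
  shows "context_of M \<epsilon> \<in> Pi\<^sub>E C D"
  unfolding solution_context[symmetric]
  using solution_in_domain[OF dag assms] C_vars by fastforce

text \<open>The restriction satisfies the equations of the residual graph: in the context
  \<open>c\<close>, filling it up by \<open>fill_parents\<close> differs from the true parent values
  at removed parents only, and \<open>fn M X\<close> does not depend on these.\<close>

lemma solution_residual:
  assumes sem: "is_sem D G M" and compat: "compatible D G C L M"
    and c: "context_of M \<epsilon> = c"
  shows "restrict (solution G M \<epsilon>) (vars G - C) = solution (residual c) (context_sem c M) \<epsilon>"
proof (rule solution_eqI[OF causal_dag_residual, symmetric])
  let ?v = "solution G M \<epsilon>"
  have v: "?v \<in> Pi\<^sub>E (vars G) D" by (rule solution_in_domain[OF dag sem])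
  have cD: "c \<in> Pi\<^sub>E C D" using context_of_domain[OF sem] c by blast
  have vc: "?v Z = c Z" if "Z \<in> C" for Z
    using solution_context[of M \<epsilon>] that c by (metis restrict_apply')
  fix X assume X: "X \<in> vars (residual c)"
  let ?w = "restrict (restrict ?v (vars G - C)) (parents (residual c) X)"
  have w: "?w Z = ?v Z" if "Z \<in> parents (residual c) X" for Z
    using that parents_residual[of c X] parents_vars[of X] by auto
  have "?v X = fn M X (restrict ?v (parents G X)) (\<epsilon> X)"
    using X by (intro solution_equation[OF dag]) simp
  also have "\<dots> = fn M X (fill_parents c X ?w) (\<epsilon> X)"
  proof (rule fn_residual[OF compat cD])
    show "restrict ?v (parents G X) \<in> Pi\<^sub>E (parents G X) D"
      using v parents_vars[of X] by auto
    have "?w Z \<in> D Z" if "Z \<in> parents (residual c) X" for Z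
      using that v parents_residual[of c X] parents_vars[of X] by (subst w) auto
    then show "fill_parents c X ?w \<in> Pi\<^sub>E (parents G X) D"
      by (rule fill_parents_domain[OF cD])
    show "restrict ?v (parents G X) Z = fill_parents c X ?w Z" if "Z \<in> parents (residual c) X" for Z
      using that parents_residual[of c X] w[OF that] by (auto simp: fill_parents_def)
  qed (use X in \<open>auto simp: ctrl_parents_def fill_parents_def vc\<close>)
  finally show "restrict ?v (vars G - C) X = fn (context_sem c M) X ?w (\<epsilon> X)"
    using X by (simp add: context_sem_def)
qed simp

text \<open>Expressed by the noise of \<open>C\<close> only, and thus visibly untouched by
  interventions outside \<open>C\<close>.\<close>

definition ctrl_prob :: "('v, 'a) sem \<Rightarrow> ('v \<Rightarrow> 'a) \<Rightarrow> real" where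
  "ctrl_prob M c = measure_pmf.prob (Pi_pmf C 0 (noise M)) {\<epsilon>. context_of M \<epsilon> = c}"

text \<open>The noise splits into independent parts on \<open>C\<close> and off \<open>C\<close>.
  The first determines the context; once this is \<open>c\<close>, the second determines the
  residual solution.\<close>

lemma joint_law_factor:
  assumes sem: "is_sem D G M" and compat: "compatible D G C L M"
  shows "measure_pmf.prob (joint_law G M) {v. restrict v C = c \<and> Q (restrict v (vars G - C))}
    = ctrl_prob M c * measure_pmf.prob (joint_law (residual c) (context_sem c M)) {w. Q w}"
proof -
  let ?sol = "solution (residual c) (context_sem c M)"
  let ?PC = "Pi_pmf C 0 (noise M)" and ?PR = "Pi_pmf (vars G - C) 0 (noise M)"
  let ?join = "\<lambda>(f, g) X. if X \<in> C then f X else g X"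
  have "Pi_pmf (C \<union> (vars G - C)) 0 (noise M) = map_pmf ?join (pair_pmf ?PC ?PR)"
    using finite_vars C_vars by (intro Pi_pmf_union) (auto intro: finite_subset)
  moreover have "C \<union> (vars G - C) = vars G" using C_vars by blast
  ultimately have split: "Pi_pmf (vars G) 0 (noise M) = map_pmf ?join (pair_pmf ?PC ?PR)"
    by simp
  have ctx: "context_of M (?join (f, g)) = context_of M f" for f g
    by (auto simp: context_of_def)
  have sol: "?sol (?join (f, g)) = ?sol g" for f g
    by (rule solution_noise_cong[OF causal_dag_residual]) auto
  have "{\<epsilon>. restrict (solution G M \<epsilon>) C = c \<and> Q (restrict (solution G M \<epsilon>) (vars G - C))}
      = {\<epsilon>. context_of M \<epsilon> = c \<and> Q (?sol \<epsilon>)}"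
    using solution_residual[OF sem compat] by (auto simp: solution_context)
  then have "measure_pmf.prob (joint_law G M) {v. restrict v C = c \<and> Q (restrict v (vars G - C))}
      = measure_pmf.prob (pair_pmf ?PC ?PR) (?join -` {\<epsilon>. context_of M \<epsilon> = c \<and> Q (?sol \<epsilon>)})"
    by (simp add: joint_law_def split vimage_def)
  also have "?join -` {\<epsilon>. context_of M \<epsilon> = c \<and> Q (?sol \<epsilon>)}
      = {f. context_of M f = c} \<times> {g. Q (?sol g)}"
    using ctx sol by auto
  finally have lhs: "measure_pmf.prob (joint_law G M)
      {v. restrict v C = c \<and> Q (restrict v (vars G - C))}
      = ctrl_prob M c * measure_pmf.prob ?PR {g. Q (?sol g)}"
    by (simp only: measure_pair_pmf_times ctrl_prob_def)
  have "noise (context_sem c M) = noise M" by (simp add: context_sem_def)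
  then have "measure_pmf.prob (joint_law (residual c) (context_sem c M)) {w. Q w}
      = measure_pmf.prob ?PR {g. Q (?sol g)}"
    by (simp add: joint_law_def vimage_def)
  then show ?thesis by (simp only: lhs)
qed

lemma ctrl_prob_eq:
  assumes "is_sem D G M" "compatible D G C L M"
  shows "ctrl_prob M c = measure_pmf.prob (joint_law G M) {v. restrict v C = c}"
  using joint_law_factor[OF assms, of c "\<lambda>_. True"] by simp

lemma restrict_obs_C: "restrict (restrict v (obs G)) C = restrict v C"
  using C_obs by (simp add: Int_absorb1)

lemma restrict_obs_rest:
  "restrict (restrict v (vars G - C)) (obs G - C) = restrict (restrict v (obs G)) (obs G - C)"
  using obs_vars by (intro ext) auto

lemma context_prob_obs_law:
  assumes "is_sem D G M" "compatible D G C L M"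
  shows "context_prob D (obs G) C c (obs_law G M) = ctrl_prob M c"
  using sum_obs_law[OF dag assms(1), of "\<lambda>n. restrict n C = c"]
  by (simp only: context_prob_def ctrl_prob_eq[OF assms] restrict_obs_C)

lemma obs_law_factor:
  assumes "is_sem D G M" "compatible D G C L M" and n: "n \<in> Pi\<^sub>E (obs G) D"
  defines "c \<equiv> restrict n C"
  shows "obs_law G M n
    = ctrl_prob M c * obs_law (residual c) (context_sem c M) (restrict n (obs G - C))"
proof -
  have "restrict v (obs G) = n \<longleftrightarrow> restrict v C = c \<and>
      restrict (restrict v (vars G - C)) (obs G - C) = restrict n (obs G - C)" for v
  proof
    assume "restrict v (obs G) = n"
    then show "restrict v C = c \<and>
        restrict (restrict v (vars G - C)) (obs G - C) = restrict n (obs G - C)"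
      using restrict_obs_C[of v] restrict_obs_rest[of v] by (simp only: c_def)
  next
    assume R: "restrict v C = c \<and>
        restrict (restrict v (vars G - C)) (obs G - C) = restrict n (obs G - C)"
    show "restrict v (obs G) = n"
    proof (rule extensionalityI[of _ "obs G"])
      fix Z assume Z: "Z \<in> obs G"
      show "restrict v (obs G) Z = n Z"
      proof (cases "Z \<in> C")
        case True
        then show ?thesis using fun_cong[OF conjunct1[OF R], of Z] Z by (simp add: c_def)
      next
        case False
        then show ?thesis using fun_cong[OF conjunct2[OF R], of Z] Z obs_vars by auto
      qed
    qed (use n in \<open>auto simp: PiE_def\<close>)
  qed
  then show ?thesis
    by (simp only: obs_law_def obs_residual
        joint_law_factor[OF assms(1,2), where Q = "\<lambda>w. restrict w (obs G - C) = restrict n (obs G - C)"])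
qed

lemma context_law_obs_law:
  assumes "is_sem D G M" "compatible D G C L M" "ctrl_prob M c \<noteq> 0"
  shows "context_law D (obs G) C c (obs_law G M) = obs_law (residual c) (context_sem c M)"
proof
  fix n'
  have "(\<Sum>n\<in>{n \<in> Pi\<^sub>E (obs G) D. restrict n C = c \<and> restrict n (obs G - C) = n'}. obs_law G M n)
      = ctrl_prob M c * obs_law (residual c) (context_sem c M) n'"
    unfolding sum_obs_law[OF dag assms(1)] restrict_obs_C restrict_obs_rest[symmetric]
      joint_law_factor[OF assms(1,2), where Q = "\<lambda>w. restrict w (obs G - C) = n'"]
    by (simp add: obs_law_def)
  then show "context_law D (obs G) C c (obs_law G M) n' = obs_law (residual c) (context_sem c M) n'"
    by (simp only: context_law_def context_prob_obs_law[OF assms(1,2)])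
      (simp add: assms(3))
qed

text \<open>Not restricted to the observed variables: \<open>glue n w\<close> later combines an
  observed assignment with a solution on all of \<open>vars G - C\<close>.\<close>

definition glue :: "('v \<Rightarrow> 'a) \<Rightarrow> ('v \<Rightarrow> 'a) \<Rightarrow> 'v \<Rightarrow> 'a" where
  "glue c n = (\<lambda>Z. if Z \<in> C then c Z else n Z)"

lemma
  assumes "c \<in> Pi\<^sub>E C D" "n \<in> Pi\<^sub>E (obs G - C) D"
  shows glue_domain: "glue c n \<in> Pi\<^sub>E (obs G) D"
    and glue_ctrl: "restrict (glue c n) C = c"
    and glue_rest: "restrict (glue c n) (obs G - C) = n"
proof -
  show "glue c n \<in> Pi\<^sub>E (obs G) D"
    using assms C_obs by (auto simp: glue_def PiE_def Pi_def extensional_def)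
  show "restrict (glue c n) C = c"
    using assms by (auto simp: glue_def PiE_def extensional_def)
  show "restrict (glue c n) (obs G - C) = n"
    using assms by (auto simp: glue_def PiE_def extensional_def)
qed

lemma positive_context:
  assumes sem: "is_sem D G M" and compat: "compatible D G C L M" and pos: "positive_sem D G M"
    and c: "c \<in> Pi\<^sub>E C D"
  shows "ctrl_prob M c > 0" "positive_sem D (residual c) (context_sem c M)"
proof -
  have *: "ctrl_prob M c * obs_law (residual c) (context_sem c M) n > 0"
    if n: "n \<in> Pi\<^sub>E (obs G - C) D" for n
  proof -
    have "obs_law G M (glue c n) > 0"
      using pos glue_domain[OF c n] by (simp add: positive_sem_def)
    then show ?thesis
      by (simp only: obs_law_factor[OF sem compat glue_domain[OF c n]]
          glue_ctrl[OF c n] glue_rest[OF c n])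
  qed
  \<comment> \<open>Some \<open>n\<close> has to exist for the positive products to show that the
    weight is positive.\<close>
  have "Pi\<^sub>E (obs G - C) D \<noteq> {}"
    using nonempty_D obs_vars by (auto simp: PiE_eq_empty_iff)
  then show pos_c: "ctrl_prob M c > 0"
    using * by (auto simp: ctrl_prob_def zero_less_mult_iff)
  show "positive_sem D (residual c) (context_sem c M)"
    using * pos_c by (simp add: positive_sem_def zero_less_mult_iff)
qed

text \<open>Since \<open>T\<close> avoids \<open>C\<close>, the intervention leaves the weights of
  the contexts unchanged; it also commutes with passing to the context model. So the factorization
  of the intervened law can be summed over \<open>c\<close>.\<close>

lemma causal_effect_decomposition:
  assumes sem: "is_sem D G M" and compat: "compatible D G C L M"
    and T: "T \<inter> C = {}" and S: "S \<subseteq> obs G - C" and t: "t \<in> Pi\<^sub>E T D"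
  shows "causal_effect G M T S t s
    = (\<Sum>c\<in>Pi\<^sub>E C D. causal_effect (residual c) (context_sem c M) T S t s * ctrl_prob M c)"
proof -
  let ?M = "do_sem T t M"
  have sem': "is_sem D G ?M" and compat': "compatible D G C L ?M"
    using sem compat t by (simp_all add: is_sem_do compatible_do)
  have "ctrl_prob ?M c = ctrl_prob M c" for c
  proof -
    have "context_of ?M \<epsilon> = context_of M \<epsilon>" for \<epsilon>
      using T by (auto simp: context_of_def do_sem_def intro!: restrict_ext)
    moreover have "noise ?M = noise M" by (simp add: do_sem_def)
    ultimately show ?thesis by (simp add: ctrl_prob_def)
  qed
  moreover have "restrict v S = restrict (restrict v (vars G - C)) S" for v :: "'v \<Rightarrow> 'a"
    using S obs_vars by (intro ext) auto
  ultimately have term_eq: "measure_pmf.prob (joint_law G ?M) {v. restrict v C = c \<and> restrict v S = s}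
      = causal_effect (residual c) (context_sem c M) T S t s * ctrl_prob M c" for c
    using joint_law_factor[OF sem' compat', of c "\<lambda>w. restrict w S = s"]
    by (simp add: causal_effect_def context_sem_do mult.commute)
  have "restrict v C \<in> Pi\<^sub>E C D" if "v \<in> set_pmf (joint_law G ?M)" for v
    using joint_law_support[OF dag sem' that] C_vars by fastforce
  then show ?thesis
    unfolding term_eq[symmetric]
    using measure_pmf_finite_partition[OF finite_domain[OF C_vars], of "joint_law G ?M"
      "\<lambda>v. restrict v C" "\<lambda>v. restrict v S = s"] by (simp add: causal_effect_def)
qed

end

section \<open>Bounds, continuity and coordinatewise convergence\<close>

lemma prob_causal_effect: "0 \<le> causal_effect G M T S t s" "causal_effect G M T S t s \<le> 1"
  by (simp_all add: causal_effect_def)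

lemma continuous_on_context_prob: "continuous_on W (context_prob D A C c)"
  unfolding context_prob_def
  by (intro continuous_on_sum continuous_on_subset[OF continuous_on_product_coordinates]) simp

lemma continuous_on_context_law:
  assumes "\<And>P. P \<in> W \<Longrightarrow> context_prob D A C c P \<noteq> 0"
  shows "continuous_on W (context_law D A C c)"
  unfolding context_law_def using assms
  by (intro continuous_on_coordinatewise_then_product continuous_on_divide continuous_on_context_prob
      continuous_on_sum continuous_on_subset[OF continuous_on_product_coordinates]) auto

lemma tendsto_coordinatewise:
  fixes f :: "'b \<Rightarrow> 'i \<Rightarrow> 'c::topological_space"
  assumes "\<And>i. ((\<lambda>x. f x i) \<longlongrightarrow> l i) F"
  shows "(f \<longlongrightarrow> l) F"
proof -
  have "limitin (product_topology (\<lambda>i. euclidean) UNIV) f l F"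
    by (subst limitin_componentwise) (simp add: assms)
  then show ?thesis by (simp add: euclidean_product_topology)
qed

section \<open>Soundness\<close>

context labelled_dag
begin

lemma glueI:
  assumes "n \<in> Pi\<^sub>E (obs G) D"
  shows "n = glue (restrict n C) (restrict n (obs G - C))"
  using assms C_obs by (auto simp: glue_def PiE_def extensional_def fun_eq_iff)

lemma context_fibre:
  assumes c: "c \<in> Pi\<^sub>E C D"
  shows "{n \<in> Pi\<^sub>E (obs G) D. restrict n C = c} = glue c ` Pi\<^sub>E (obs G - C) D"
proof (intro equalityI subsetI)
  fix n assume n: "n \<in> {n \<in> Pi\<^sub>E (obs G) D. restrict n C = c}"
  then have "restrict n (obs G - C) \<in> Pi\<^sub>E (obs G - C) D" by auto
  then show "n \<in> glue c ` Pi\<^sub>E (obs G - C) D"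
    using glueI[of n] n by blast
next
  fix n assume "n \<in> glue c ` Pi\<^sub>E (obs G - C) D"
  then show "n \<in> {n \<in> Pi\<^sub>E (obs G) D. restrict n C = c}"
    using glue_domain[OF c] glue_ctrl[OF c] by blast
qed

lemma sum_context_fibre:
  assumes c: "c \<in> Pi\<^sub>E C D"
  shows "(\<Sum>n\<in>{n \<in> Pi\<^sub>E (obs G) D. restrict n C = c}. f n)
    = (\<Sum>n'\<in>Pi\<^sub>E (obs G - C) D. f (glue c n'))"
  unfolding context_fibre[OF c]
  by (subst sum.reindex) (auto intro: inj_on_inverseI[where g = "\<lambda>n. restrict n (obs G - C)"] glue_rest[OF c])

lemma context_law_glue:
  assumes c: "c \<in> Pi\<^sub>E C D" and n': "n' \<in> Pi\<^sub>E (obs G - C) D"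
  shows "context_law D (obs G) C c P n' = P (glue c n') / context_prob D (obs G) C c P"
proof -
  have "{n \<in> Pi\<^sub>E (obs G) D. restrict n C = c \<and> restrict n (obs G - C) = n'} = {glue c n'}"
    using glue_domain[OF c n'] glue_ctrl[OF c n'] glue_rest[OF c n'] glueI by auto
  then show ?thesis by (simp add: context_law_def)
qed

text \<open>Puts the conditional law into the set on which the operators for the residual graph are
  continuous.\<close>

lemma context_law_positive:
  assumes c: "c \<in> Pi\<^sub>E C D"
    and P: "P \<in> contextwise_positive_distributions D (obs G) C"
    and pos: "context_prob D (obs G) C c P > 0"
  shows "context_law D (obs G) C c P \<in> positive_distributions D (obs G - C)"
proof -
  let ?Q = "context_law D (obs G) C c P" and ?p = "context_prob D (obs G) C c P"
  have Q0: "?Q n' = 0" if "n' \<notin> Pi\<^sub>E (obs G - C) D" for n'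
  proof -
    have "{n \<in> Pi\<^sub>E (obs G) D. restrict n C = c \<and> restrict n (obs G - C) = n'} = {}"
      using that by auto
    then show ?thesis by (simp only: context_law_def) simp
  qed
  have Qpos: "?Q n' > 0" if n': "n' \<in> Pi\<^sub>E (obs G - C) D" for n'
  proof -
    have "P (glue c n') > 0"
      using P c pos glue_domain[OF c n'] glue_ctrl[OF c n']
      by (simp add: contextwise_positive_distributions_def)
    then show ?thesis using pos by (simp add: context_law_glue[OF c n'])
  qed
  have "(\<Sum>n'\<in>Pi\<^sub>E (obs G - C) D. ?Q n') = (\<Sum>n'\<in>Pi\<^sub>E (obs G - C) D. P (glue c n')) / ?p"
    by (simp add: context_law_glue[OF c] sum_divide_distrib)
  also have "\<dots> = 1"
    using pos by (simp add: sum_context_fibre[OF c, symmetric] context_prob_def)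
  finally show ?thesis
    using Q0 Qpos by (auto simp: positive_distributions_def distributions_def)
      (metis less_eq_real_def)
qed

lemma context_prob_nonneg:
  assumes "P \<in> contextwise_positive_distributions D (obs G) C"
  shows "context_prob D (obs G) C c P \<ge> 0"
  using assms
  by (auto simp: context_prob_def contextwise_positive_distributions_def distributions_def
      intro!: sum_nonneg)

text \<open>Where the context has probability \<open>0\<close>, the conditional law is the junk value \<open>0 / 0 = 0\<close>;
  boundedness of \<open>F\<close> makes the product tend to \<open>0\<close> there.\<close>

lemma continuous_on_weighted_context:
  assumes c: "c \<in> Pi\<^sub>E C D"
    and F: "continuous_on (positive_distributions D (obs G - C)) F"
    and bounded: "\<And>P. \<bar>F P\<bar> \<le> 1"
  shows "continuous_on (contextwise_positive_distributions D (obs G) C)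
    (\<lambda>P. F (context_law D (obs G) C c P) * context_prob D (obs G) C c P)"
    (is "continuous_on ?W ?g")
  unfolding continuous_on_def
proof
  fix P assume P: "P \<in> ?W"
  let ?p = "context_prob D (obs G) C c"
  show "(?g \<longlongrightarrow> ?g P) (at P within ?W)"
  proof (cases "?p P = 0")
    case True
    have "(?p \<longlongrightarrow> ?p P) (at P within ?W)"
      using continuous_on_context_prob[of ?W D "obs G" C c] P unfolding continuous_on_def by blast
    then have lim: "(?p \<longlongrightarrow> 0) (at P within ?W)" by (simp add: True)
    have "norm (?g P') \<le> ?p P'" if "P' \<in> ?W" for P'
      using context_prob_nonneg[OF that, of c] mult_right_mono[OF bounded, of "?p P'"]
      by (simp add: abs_mult)
    then have "\<forall>\<^sub>F P' in at P within ?W. norm (?g P') \<le> ?p P'"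
      by (simp add: eventually_at_filter)
    then have "(?g \<longlongrightarrow> 0) (at P within ?W)"
      using lim by (rule Lim_null_comparison)
    then show ?thesis by (simp add: True)
  next
    case False
    \<comment> \<open>Near \<open>P\<close> the context keeps positive probability, so the limit may
      be taken within the open set \<open>?U\<close>, where the conditional law is
      continuous.\<close>
    let ?U = "{P. ?p P > 0}"
    have pos: "P \<in> ?U" using False context_prob_nonneg[OF P, of c] by simp
    have "open ?U"
      by (intro open_Collect_less continuous_on_context_prob continuous_on_const)
    then have at: "at P within ?W = at P within (?W \<inter> ?U)"
      using pos by (intro at_within_nhd[of P ?U]) auto
    have "continuous_on (?W \<inter> ?U) (\<lambda>P. F (context_law D (obs G) C c P))"
      by (rule continuous_on_compose2[OF F continuous_on_context_law])
        (use context_law_positive[OF c] in auto)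
    then have "continuous_on (?W \<inter> ?U) ?g"
      by (intro continuous_on_mult continuous_on_context_prob)
    then show ?thesis
      using P pos by (simp add: at continuous_on_def)
  qed
qed

text \<open>Asks of \<open>F c\<close> only correct values on laws of positive models. So it serves
  the truncated operators, which give identifiability, as well as the formulas of the procedure,
  whose continuity is not known.\<close>

lemma causal_effect_formula:
  assumes sem: "is_sem D G M" and compat: "compatible D G C L M" and pos: "positive_sem D G M"
    and T: "T \<inter> C = {}" and S: "S \<subseteq> obs G - C" and t: "t \<in> Pi\<^sub>E T D"
    and F: "\<And>c M. \<lbrakk>c \<in> Pi\<^sub>E C D; is_sem D (residual c) M; positive_sem D (residual c) M\<rbrakk>
      \<Longrightarrow> F c (obs_law (residual c) M) = causal_effect (residual c) M T S t s"
  shows "(\<Sum>c\<in>Pi\<^sub>E C D. F c (context_law D (obs G) C c (obs_law G M))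
      * context_prob D (obs G) C c (obs_law G M)) = causal_effect G M T S t s"
  unfolding causal_effect_decomposition[OF sem compat T S t]
proof (rule sum.cong[OF refl])
  fix c assume c: "c \<in> Pi\<^sub>E C D"
  note pos_c = positive_context[OF sem compat pos c]
  show "F c (context_law D (obs G) C c (obs_law G M)) * context_prob D (obs G) C c (obs_law G M)
      = causal_effect (residual c) (context_sem c M) T S t s * ctrl_prob M c"
    using pos_c(1) F[OF c is_sem_context[OF sem c] pos_c(2)]
    by (simp add: context_law_obs_law[OF sem compat] context_prob_obs_law[OF sem compat])
qed

lemma identifiable_if_residual:
  assumes T: "T \<inter> C = {}" and S: "S \<subseteq> obs G - C"
    and id: "\<And>c. c \<in> Pi\<^sub>E C D \<Longrightarrow> identifiable_dag D (residual c) T S"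
  shows "identifiable D G C L T S"
  unfolding identifiable_def
proof (intro ballI)
  fix t s assume t: "t \<in> Pi\<^sub>E T D" and s: "s \<in> Pi\<^sub>E S D"
  have "\<exists>F. continuous_on (positive_distributions D (obs G - C)) F \<and>
      (\<forall>M. is_sem D (residual c) M \<and> positive_sem D (residual c) M
        \<longrightarrow> F (obs_law (residual c) M) = causal_effect (residual c) M T S t s)"
    if "c \<in> Pi\<^sub>E C D" for c
    using id[OF that] t s by (simp add: identifiable_dag_def)
  then obtain F where cont: "\<And>c. c \<in> Pi\<^sub>E C D \<Longrightarrow> continuous_on (positive_distributions D (obs G - C)) (F c)"
    and F: "\<And>c M. \<lbrakk>c \<in> Pi\<^sub>E C D; is_sem D (residual c) M; positive_sem D (residual c) M\<rbrakk>
      \<Longrightarrow> F c (obs_law (residual c) M) = causal_effect (residual c) M T S t s"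
    by metis
  \<comment> \<open>Nothing is known about \<open>F c\<close> off the laws of models, so it has to be made bounded.\<close>
  define F' where "F' c P = max 0 (min 1 (F c P))" for c P
  \<comment> \<open>Truncation changes nothing on laws of models, where the value is a
    probability.\<close>
  have F': "F' c (obs_law (residual c) M) = causal_effect (residual c) M T S t s"
    if "c \<in> Pi\<^sub>E C D" "is_sem D (residual c) M" "positive_sem D (residual c) M" for c M
    using F[OF that] prob_causal_effect[of "residual c" M T S t s] by (simp add: F'_def)
  have "continuous_on (contextwise_positive_distributions D (obs G) C)
      (\<lambda>P. \<Sum>c\<in>Pi\<^sub>E C D. F' c (context_law D (obs G) C c P) * context_prob D (obs G) C c P)"
  proof (intro continuous_on_sum continuous_on_weighted_context)
    fix c assume "c \<in> Pi\<^sub>E C D"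
    then show "continuous_on (positive_distributions D (obs G - C)) (F' c)"
      unfolding F'_def by (intro continuous_on_max continuous_on_min continuous_on_const cont)
  qed (auto simp: F'_def)
  moreover have "(\<Sum>c\<in>Pi\<^sub>E C D. F' c (context_law D (obs G) C c (obs_law G M))
      * context_prob D (obs G) C c (obs_law G M)) = causal_effect G M T S t s"
    if "is_sem D G M \<and> compatible D G C L M \<and> positive_sem D G M" for M
    using that by (intro causal_effect_formula[OF _ _ _ T S t F']) auto
  ultimately show "\<exists>F. continuous_on (contextwise_positive_distributions D (obs G) C) F \<and>
      (\<forall>M. is_sem D G M \<and> compatible D G C L M \<and> positive_sem D G M
        \<longrightarrow> F (obs_law G M) = causal_effect G M T S t s)"
    by blast
qed

end

section \<open>Completeness\<close>

text \<open>A mixture of the uniform distribution on \<open>A\<close> with the point mass at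
  \<open>a\<close>: it charges all of \<open>A\<close>, as positivity demands, and tends to the
  point mass as \<open>\<delta>\<close> tends to 0.\<close>

definition near_point_pmf :: "real \<Rightarrow> 'a \<Rightarrow> 'a set \<Rightarrow> 'a pmf" where
  "near_point_pmf \<delta> a A =
     bind_pmf (bernoulli_pmf \<delta>) (\<lambda>b. if b then pmf_of_set A else return_pmf a)"

lemma near_point_pmf_ge:
  assumes "0 \<le> \<delta>" "\<delta> \<le> 1"
  shows "pmf (near_point_pmf \<delta> a A) a \<ge> 1 - \<delta>"
  using assms by (simp add: near_point_pmf_def pmf_bind)

lemma set_near_point_pmf:
  assumes "0 < \<delta>" "\<delta> < 1" "finite A" "A \<noteq> {}"
  shows "A \<subseteq> set_pmf (near_point_pmf \<delta> a A)"
proof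
  fix x assume "x \<in> A"
  then have "x \<in> set_pmf (if True then pmf_of_set A else return_pmf a)"
    using assms by auto
  moreover have "True \<in> set_pmf (bernoulli_pmf \<delta>)"
    using assms by simp
  ultimately show "x \<in> set_pmf (near_point_pmf \<delta> a A)"
    unfolding near_point_pmf_def set_bind_pmf by blast
qed

context labelled_dag
begin

lemma countable_D: "X \<in> vars G \<Longrightarrow> countable (D X)"
  using finite_D by (rule countable_finite)

text \<open>The noise of a variable outside \<open>C\<close> encodes a pair: the first component drives \<open>M'\<close>, the
  second one is the value of the variable when its control parents disagree with \<open>c\<close>.\<close>

definition extend_sem :: "('v \<Rightarrow> 'a) \<Rightarrow> ('v, 'a) sem \<Rightarrow> real \<Rightarrow> ('v, 'a) sem" where
  "extend_sem c M' \<delta> = \<lparr>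
     fn = \<lambda>X p e.
       if X \<in> C then from_nat_into (D X) e
       else if \<forall>Z\<in>ctrl_parents G C X. p Z = c Z
         then fn M' X (restrict p (parents (residual c) X)) (fst (prod_decode e))
       else from_nat_into (D X) (snd (prod_decode e)),
     noise = \<lambda>X.
       if X \<in> C then map_pmf (to_nat_on (D X)) (near_point_pmf \<delta> (c X) (D X))
       else map_pmf prod_encode
         (pair_pmf (noise M' X) (map_pmf (to_nat_on (D X)) (pmf_of_set (D X))))\<rparr>"

lemma is_sem_extend:
  assumes "is_sem D (residual c) M'"
  shows "is_sem D G (extend_sem c M' \<delta>)"
  unfolding is_sem_def
proof (intro ballI allI)
  fix X p e assume X: "X \<in> vars G" and p: "p \<in> Pi\<^sub>E (parents G X) D"
  have "restrict p (parents (residual c) X) \<in> Pi\<^sub>E (parents (residual c) X) D"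
    using p parents_residual[of c X] by auto
  \<comment> \<open>\<open>from_nat_into\<close> maps every number into the non-empty set
    \<open>D X\<close>, also numbers that encode no value.\<close>
  then show "fn (extend_sem c M' \<delta>) X p e \<in> D X"
    using assms X nonempty_D[OF X] by (auto simp: extend_sem_def is_sem_def from_nat_into)
qed

text \<open>If the context \<open>c'\<close> of a label agrees with \<open>c\<close> on the control
  parents of \<open>X\<close>, the edge is missing from the residual graph and \<open>M'\<close>
  never sees \<open>Y\<close>. Otherwise the value of \<open>X\<close> is read off its
  noise.\<close>

lemma compatible_extend: "compatible D G C L (extend_sem c M' \<delta>)"
proof (rule compatibleI)
  fix c' Y X p q e
  assume c': "c' \<in> Pi\<^sub>E C D" "(Y, X) \<in> L c'"
    and pq: "\<And>Z. Z \<in> ctrl_parents G C X \<Longrightarrow> p Z = c' Z \<and> q Z = c' Z"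
      "\<And>Z. Z \<in> parents G X - {Y} \<Longrightarrow> p Z = q Z"
  have X: "X \<notin> C" using labelD(2)[OF c'] .
  show "fn (extend_sem c M' \<delta>) X p e = fn (extend_sem c M' \<delta>) X q e"
  proof (cases "\<forall>Z\<in>ctrl_parents G C X. c' Z = c Z")
    case True
    then have "restrict c' (ctrl_parents G C X) = restrict c (ctrl_parents G C X)"
      by (intro restrict_ext) blast
    then have "Y \<notin> parents (residual c) X"
      using c' by (auto simp: parents_def residual_graph_def)
    then have "restrict p (parents (residual c) X) = restrict q (parents (residual c) X)"
      using pq(2) parents_residual[of c X] by (intro restrict_ext) blast
    then show ?thesis using X True pq(1) by (simp add: extend_sem_def)
  next
    case False
    then have "\<not> (\<forall>Z\<in>ctrl_parents G C X. p Z = c Z)" "\<not> (\<forall>Z\<in>ctrl_parents G C X. q Z = c Z)"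
      using pq(1) by auto
    then show ?thesis using X by (simp only: extend_sem_def sem.simps if_False)
  qed
qed

text \<open>\<open>fill_parents\<close> sets the control parents to \<open>c\<close>, so
  \<open>M'\<close> is always in charge and the second noise components are forgotten. The
  intervention is included so that \<open>T = {}\<close> yields the observed law too.\<close>

lemma joint_law_extend:
  "joint_law (residual c) (do_sem T t (context_sem c (extend_sem c M' \<delta>)))
    = joint_law (residual c) (do_sem T t M')"
proof (rule joint_law_reparametrize[OF causal_dag_residual, where g = "\<lambda>e. fst (prod_decode e)"])
  fix X assume X: "X \<in> vars (residual c)"
  have "noise (extend_sem c M' \<delta>) X = map_pmf prod_encode
      (pair_pmf (noise M' X) (map_pmf (to_nat_on (D X)) (pmf_of_set (D X))))"
    using X by (simp add: extend_sem_def)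
  then show "noise (do_sem T t M') X
      = map_pmf (\<lambda>e. fst (prod_decode e)) (noise (do_sem T t (context_sem c (extend_sem c M' \<delta>))) X)"
    by (simp add: do_sem_def context_sem_def map_pmf_comp map_fst_pair_pmf)
next
  fix X and p :: "'v \<Rightarrow> 'a" and e
  assume X: "X \<in> vars (residual c)" and p: "p \<in> extensional (parents (residual c) X)"
  have "restrict (fill_parents c X p) (parents (residual c) X) = p"
    by (rule extensionalityI[OF restrict_extensional p])
      (use parents_residual[of c X] in \<open>auto simp: fill_parents_def\<close>)
  then show "fn (do_sem T t (context_sem c (extend_sem c M' \<delta>))) X p e
      = fn (do_sem T t M') X p (fst (prod_decode e))"
    using X by (simp add: do_sem_def context_sem_def extend_sem_def)
      (simp add: fill_parents_def ctrl_parents_def)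
next
  \<comment> \<open>The default noise 0 encodes the pair \<open>(0, 0)\<close>.\<close>
  have "prod_decode (prod_encode (0, 0)) = (0, 0)" by (rule prod_encode_inverse)
  then show "fst (prod_decode 0) = 0" by (simp add: prod_encode_def)
qed

lemma
  shows causal_effect_extend: "causal_effect (residual c) (context_sem c (extend_sem c M' \<delta>)) T S t s
      = causal_effect (residual c) M' T S t s"
    and obs_law_extend: "obs_law (residual c) (context_sem c (extend_sem c M' \<delta>))
      = obs_law (residual c) M'"
proof -
  show "causal_effect (residual c) (context_sem c (extend_sem c M' \<delta>)) T S t s
      = causal_effect (residual c) M' T S t s"
    by (simp add: causal_effect_def joint_law_extend)
  have "do_sem {} t M = M" for t and M :: "('v, 'a) sem" by (simp add: do_sem_def)
  then show "obs_law (residual c) (context_sem c (extend_sem c M' \<delta>)) = obs_law (residual c) M'"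
    using joint_law_extend[of c "{}" undefined M' \<delta>] by (simp add: obs_law_def fun_eq_iff)
qed

text \<open>Starting from noise for which \<open>M'\<close> produces the wanted values, the second components can
  be chosen such that the variables that see another context take these values, too.\<close>

lemma positive_extend:
  assumes sem: "is_sem D (residual c) M'" and pos: "positive_sem D (residual c) M'"
    and \<delta>: "0 < \<delta>" "\<delta> < 1"
  shows "positive_sem D G (extend_sem c M' \<delta>)"
  unfolding positive_sem_def
proof
  fix n assume n: "n \<in> Pi\<^sub>E (obs G) D"
  let ?E = "extend_sem c M' \<delta>" and ?n' = "restrict n (obs G - C)"
  have "?n' \<in> Pi\<^sub>E (obs G - C) D" using n by auto
  then have "obs_law (residual c) M' ?n' > 0"
    using pos unfolding positive_sem_def obs_residual by blast
  then have "obs_law (residual c) M' ?n' \<noteq> 0"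
    by simp
  then obtain \<epsilon>' where \<epsilon>': "\<epsilon>' \<in> set_pmf (Pi_pmf (vars G - C) 0 (noise M'))"
      "restrict (solution (residual c) M' \<epsilon>') (obs G - C) = ?n'"
    by (auto simp: obs_law_def joint_law_def measure_pmf_zero_iff)
  define w where "w = solution (residual c) M' \<epsilon>'"
  define v where "v = glue n w"
  \<comment> \<open>The first component makes \<open>M'\<close> produce \<open>w X\<close>, the
    second encodes \<open>w X\<close> itself; 0 is the default of \<open>Pi_pmf\<close> outside the
    graph.\<close>
  define \<epsilon> where "\<epsilon> X = (if X \<in> C then to_nat_on (D X) (n X)
    else if X \<in> vars G then prod_encode (\<epsilon>' X, to_nat_on (D X) (w X)) else 0)" for X
  have w: "w \<in> Pi\<^sub>E (vars G - C) D"
    using solution_in_domain[OF causal_dag_residual sem] by (simp add: w_def)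
  have nD: "n X \<in> D X" if "X \<in> C" for X using that n C_obs by auto
  have "solution G ?E \<epsilon> = v"
  proof (rule solution_eqI[OF dag])
    show "v \<in> extensional (vars G)"
      using w C_vars by (auto simp: v_def glue_def PiE_def extensional_def)
    fix X assume X: "X \<in> vars G"
    show "v X = fn ?E X (restrict v (parents G X)) (\<epsilon> X)"
    proof (cases "X \<in> C")
      case True
      then show ?thesis
        using nD countable_D[OF X] by (simp add: v_def glue_def extend_sem_def \<epsilon>_def)
    next
      case False
      have "restrict (restrict v (parents G X)) (parents (residual c) X)
          = restrict w (parents (residual c) X)"
        using parents_residual[of c X] by (intro ext) (auto simp: v_def glue_def)
      moreover have "w X = fn M' X (restrict w (parents (residual c) X)) (\<epsilon>' X)"
        unfolding w_def using X False by (intro solution_equation[OF causal_dag_residual]) simp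
      moreover have "w X \<in> D X" using w X False by auto
      \<comment> \<open>Both branches yield \<open>w X\<close>, whether or not the control parents
        agree with \<open>c\<close>.\<close>
      ultimately show ?thesis
        using X False countable_D[OF X] by (simp add: v_def glue_def extend_sem_def \<epsilon>_def)
    qed
  qed
  moreover have "restrict v (obs G) = n"
  proof (rule extensionalityI[of _ "obs G"])
    fix X assume X: "X \<in> obs G"
    show "restrict v (obs G) X = n X"
      using fun_cong[OF \<epsilon>'(2), of X] X by (auto simp: v_def glue_def w_def split: if_splits)
  qed (use n in \<open>auto simp: PiE_def\<close>)
  moreover have "\<epsilon> \<in> set_pmf (Pi_pmf (vars G) 0 (noise ?E))"
  proof -
    have "\<epsilon> X \<in> set_pmf (noise ?E X)" if X: "X \<in> vars G" for X
    proof (cases "X \<in> C")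
      case True
      \<comment> \<open>The perturbed noise of \<open>C\<close> charges every value, so the context
        of \<open>n\<close> is possible even if it differs from \<open>c\<close>.\<close>
      then show ?thesis
        using nD set_near_point_pmf[OF \<delta> finite_D[OF X] nonempty_D[OF X], of "c X"]
        by (auto simp: \<epsilon>_def extend_sem_def)
    next
      case False
      then have "\<epsilon>' X \<in> set_pmf (noise M' X)"
        using \<epsilon>'(1) X finite_vars by (simp add: set_Pi_pmf PiE_dflt_def)
      moreover have "w X \<in> set_pmf (pmf_of_set (D X))"
        using w X False finite_D[OF X] nonempty_D[OF X] by auto
      ultimately show ?thesis
        using X False by (auto simp: \<epsilon>_def extend_sem_def)
    qed
    moreover have "\<epsilon> X = 0" if "X \<notin> vars G" for X
      using that C_vars by (auto simp: \<epsilon>_def)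
    ultimately show ?thesis
      using finite_vars by (simp add: set_Pi_pmf PiE_dflt_def)
  qed
  ultimately show "obs_law G ?E n > 0"
    unfolding obs_law_def joint_law_def by (intro measure_pmf_posI[of v]) auto
qed

text \<open>The control variables are independent, and each takes its value in \<open>c\<close> with
  probability at least \<open>1 - \<delta>\<close>.\<close>

lemma ctrl_prob_extend_ge:
  assumes c: "c \<in> Pi\<^sub>E C D" and \<delta>: "0 \<le> \<delta>" "\<delta> \<le> 1"
  shows "ctrl_prob (extend_sem c M' \<delta>) c \<ge> (1 - \<delta>) ^ card C"
proof -
  let ?E = "extend_sem c M' \<delta>"
  let ?B = "\<lambda>X. {e. from_nat_into (D X) e = c X}"
  have fin: "finite C" using C_vars finite_vars by (rule finite_subset)
  have "context_of ?E \<epsilon> = (\<lambda>X\<in>C. from_nat_into (D X) (\<epsilon> X))" for \<epsilon>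
    unfolding context_of_def by (rule restrict_ext) (simp add: extend_sem_def)
  then have "{\<epsilon>. context_of ?E \<epsilon> = c} = Pi C ?B"
    using PiE_arb[OF c] by (auto simp: fun_eq_iff)
  then have "ctrl_prob ?E c = (\<Prod>X\<in>C. measure_pmf.prob (noise ?E X) (?B X))"
    by (simp add: ctrl_prob_def measure_Pi_pmf_Pi[OF fin])
  moreover have "1 - \<delta> \<le> measure_pmf.prob (noise ?E X) (?B X)" if X: "X \<in> C" for X
  proof -
    have "1 - \<delta> \<le> measure_pmf.prob (near_point_pmf \<delta> (c X) (D X)) {c X}"
      using near_point_pmf_ge[OF \<delta>] by (simp add: measure_pmf_single)
    also have "\<dots> \<le> measure_pmf.prob (near_point_pmf \<delta> (c X) (D X))
        {a. from_nat_into (D X) (to_nat_on (D X) a) = c X}"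
      using from_nat_into_to_nat_on[OF countable_D PiE_mem[OF c X]] X C_vars
      by (intro measure_pmf.finite_measure_mono) auto
    finally show ?thesis using X by (simp add: extend_sem_def vimage_def)
  qed
  then have "(\<Prod>X\<in>C. 1 - \<delta>) \<le> (\<Prod>X\<in>C. measure_pmf.prob (noise ?E X) (?B X))"
    using \<delta> by (intro prod_mono) auto
  ultimately show ?thesis by simp
qed

section \<open>Limits of the extended models\<close>

lemma sum_ctrl_prob:
  assumes "is_sem D G M" "compatible D G C L M"
  shows "(\<Sum>c\<in>Pi\<^sub>E C D. ctrl_prob M c) = 1"
proof -
  have "restrict v C \<in> Pi\<^sub>E C D" if "v \<in> set_pmf (joint_law G M)" for v
    using joint_law_support[OF dag assms(1) that] C_vars by fastforce
  then show ?thesis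
    using measure_pmf_finite_partition[OF finite_domain[OF C_vars], of "joint_law G M"
      "\<lambda>v. restrict v C" "\<lambda>_. True"] by (simp add: ctrl_prob_eq[OF assms])
qed

text \<open>This total weight bounds the contribution of all contexts other than
  \<open>c\<close>.\<close>

lemma sum_other_ctrl_prob:
  assumes "is_sem D G M" "compatible D G C L M" "c \<in> Pi\<^sub>E C D"
  shows "(\<Sum>c\<in>Pi\<^sub>E C D - {c}. ctrl_prob M c) = 1 - ctrl_prob M c"
  using sum_ctrl_prob[OF assms(1,2)] finite_domain[OF C_vars] assms(3)
  by (simp add: sum_diff1)

definition embed_context :: "('v \<Rightarrow> 'a) \<Rightarrow> (('v \<Rightarrow> 'a) \<Rightarrow> real) \<Rightarrow> ('v \<Rightarrow> 'a) \<Rightarrow> real" where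
  "embed_context c P n =
     (if n \<in> Pi\<^sub>E (obs G) D \<and> restrict n C = c then P (restrict n (obs G - C)) else 0)"

text \<open>Lets an operator for the labelled graph be pulled back to the residual graph.\<close>

lemma continuous_on_embed_context: "continuous_on W (embed_context c)"
proof (rule continuous_on_coordinatewise_then_product)
  fix n
  show "continuous_on W (\<lambda>P. embed_context c P n)"
  proof (cases "n \<in> Pi\<^sub>E (obs G) D \<and> restrict n C = c")
    case True
    show ?thesis
      unfolding embed_context_def if_P[OF True]
      by (rule continuous_on_subset[OF continuous_on_product_coordinates]) simp
  next
    case False
    show ?thesis
      unfolding embed_context_def if_not_P[OF False] by (rule continuous_on_const)
  qed
qed

text \<open>Contexts other than \<open>c\<close> get probability 0 and impose no condition; on
  \<open>c\<close> positivity is that of \<open>P\<close>. As soon as there is a second context, the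
  result is not a positive distribution, so continuity on the positive ones would say nothing
  here.\<close>

lemma embed_context_domain:
  assumes c: "c \<in> Pi\<^sub>E C D" and P: "P \<in> positive_distributions D (obs G - C)"
  shows "embed_context c P \<in> contextwise_positive_distributions D (obs G) C"
proof -
  have nn: "P n \<ge> 0" for n
    using P by (simp add: positive_distributions_def distributions_def)
  have "(\<Sum>n\<in>Pi\<^sub>E (obs G) D. embed_context c P n)
      = (\<Sum>n\<in>{n \<in> Pi\<^sub>E (obs G) D. restrict n C = c}. embed_context c P n)"
    using finite_domain[OF obs_vars] by (intro sum.mono_neutral_right) (auto simp: embed_context_def)
  also have "\<dots> = (\<Sum>n\<in>Pi\<^sub>E (obs G - C) D. P n)"
    unfolding sum_context_fibre[OF c]
    by (intro sum.cong)
      (simp_all add: embed_context_def glue_domain[OF c] glue_ctrl[OF c] glue_rest[OF c])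
  also have "\<dots> = 1"
    using P by (simp add: positive_distributions_def distributions_def)
  finally have "embed_context c P \<in> distributions D (obs G)"
    using nn by (simp add: distributions_def) (simp add: embed_context_def)
  moreover have "embed_context c P n > 0"
    if c': "context_prob D (obs G) C c' (embed_context c P) > 0"
      and n: "n \<in> Pi\<^sub>E (obs G) D" "restrict n C = c'" for c' n
  proof -
    have "c' = c"
    proof (rule ccontr)
      assume "c' \<noteq> c"
      then have "context_prob D (obs G) C c' (embed_context c P) = 0"
        unfolding context_prob_def by (intro sum.neutral) (auto simp: embed_context_def)
      then show False using c' by simp
    qed
    moreover have "restrict n (obs G - C) \<in> Pi\<^sub>E (obs G - C) D" using n by auto
    ultimately show ?thesis
      using P n by (simp add: embed_context_def positive_distributions_def)
  qed
  ultimately show ?thesis by (simp add: contextwise_positive_distributions_def)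
qed

lemma
  assumes sem: "is_sem D (residual c) M'" and c: "c \<in> Pi\<^sub>E C D"
  shows obs_law_extend_limit: "(\<lambda>k. obs_law G (extend_sem c M' (1 / (real k + 2))))
      \<longlonglongrightarrow> embed_context c (obs_law (residual c) M')"
    and causal_effect_extend_limit:
      "\<lbrakk>T \<inter> C = {}; S \<subseteq> obs G - C; t \<in> Pi\<^sub>E T D\<rbrakk>
        \<Longrightarrow> (\<lambda>k. causal_effect G (extend_sem c M' (1 / (real k + 2))) T S t s)
          \<longlonglongrightarrow> causal_effect (residual c) M' T S t s"
proof -
  \<comment> \<open>\<open>1 / (k + 2)\<close> lies strictly between 0 and 1 for every
    \<open>k\<close>, as positivity of the extended models requires.\<close>
  let ?E = "\<lambda>k. extend_sem c M' (1 / (real k + 2))"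
  let ?p = "\<lambda>k. ctrl_prob (?E k) c"
  note semE = is_sem_extend[OF sem] and compatE = compatible_extend
  have p: "?p \<longlonglongrightarrow> 1"
  proof (rule tendsto_sandwich)
    show "\<forall>\<^sub>F k in sequentially. (1 - 1 / (real k + 2)) ^ card C \<le> ?p k"
      by (intro always_eventually allI ctrl_prob_extend_ge[OF c]) auto
    show "\<forall>\<^sub>F k in sequentially. ?p k \<le> 1"
      by (simp add: ctrl_prob_def)
    have "(\<lambda>k. 1 / (real k + 2)) \<longlonglongrightarrow> 0" by real_asymp
    then have "(\<lambda>k. (1 - 1 / (real k + 2)) ^ card C) \<longlonglongrightarrow> (1 - 0) ^ card C"
      by (intro tendsto_intros)
    then show "(\<lambda>k. (1 - 1 / (real k + 2)) ^ card C) \<longlonglongrightarrow> 1" by simp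
  qed simp
  have p': "(\<lambda>k. 1 - ?p k) \<longlonglongrightarrow> 0"
    using tendsto_diff[OF tendsto_const p, of 1] by simp
  show "(\<lambda>k. obs_law G (?E k)) \<longlonglongrightarrow> embed_context c (obs_law (residual c) M')"
  proof (rule tendsto_coordinatewise)
    fix n
    show "(\<lambda>k. obs_law G (?E k) n) \<longlonglongrightarrow> embed_context c (obs_law (residual c) M') n"
    proof (cases "n \<in> Pi\<^sub>E (obs G) D")
      case False
      then have "obs_law G (?E k) n = 0" for k
        using obs_law_distribution[OF dag semE] by (auto simp: distributions_def)
      then show ?thesis using False by (simp add: embed_context_def)
    next
      case n: True
      show ?thesis
      proof (cases "restrict n C = c")
        case True
        \<comment> \<open>Within \<open>c\<close> the residual law is that of \<open>M'\<close> for
          every \<open>k\<close>; only the weight moves.\<close>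
        have "obs_law G (?E k) n = ?p k * obs_law (residual c) M' (restrict n (obs G - C))" for k
          using obs_law_factor[OF semE compatE n] by (simp only: True obs_law_extend)
        then show ?thesis
          using tendsto_mult_right[OF p] n True by (simp add: embed_context_def)
      next
        case False
        have "norm (obs_law G (?E k) n) \<le> 1 - ?p k" for k
        proof -
          let ?c = "restrict n C"
          have nC: "?c \<in> Pi\<^sub>E C D" using n C_obs by auto
          have "obs_law G (?E k) n \<le> ctrl_prob (?E k) ?c"
            unfolding obs_law_factor[OF semE compatE n]
            by (intro mult_left_le) (simp_all add: obs_law_def ctrl_prob_def)
          also have "\<dots> \<le> (\<Sum>c\<in>Pi\<^sub>E C D - {c}. ctrl_prob (?E k) c)"
            using nC False finite_domain[OF C_vars]
            by (intro member_le_sum) (auto simp: ctrl_prob_def)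
          finally show ?thesis
            unfolding sum_other_ctrl_prob[OF semE compatE c] by (simp add: obs_law_def)
        qed
        then have "(\<lambda>k. obs_law G (?E k) n) \<longlonglongrightarrow> 0"
          by (intro Lim_null_comparison[OF _ p'] always_eventually allI)
        then show ?thesis using False by (simp add: embed_context_def)
      qed
    qed
  qed
  assume T: "T \<inter> C = {}" and S: "S \<subseteq> obs G - C" and t: "t \<in> Pi\<^sub>E T D"
  let ?e = "\<lambda>k c'. causal_effect (residual c') (context_sem c' (?E k)) T S t s"
  let ?rest = "\<lambda>k. \<Sum>c'\<in>Pi\<^sub>E C D - {c}. ?e k c' * ctrl_prob (?E k) c'"
  have "causal_effect G (?E k) T S t s = causal_effect (residual c) M' T S t s * ?p k + ?rest k" for k
    unfolding causal_effect_decomposition[OF semE compatE T S t]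
    using sum.remove[OF finite_domain[OF C_vars] c, of "\<lambda>c'. ?e k c' * ctrl_prob (?E k) c'"]
    by (simp only: causal_effect_extend)
  moreover have "?rest \<longlonglongrightarrow> 0"
  proof (rule Lim_null_comparison[OF _ p'], intro always_eventually allI)
    fix k
    have "?rest k \<le> (\<Sum>c'\<in>Pi\<^sub>E C D - {c}. ctrl_prob (?E k) c')"
      by (intro sum_mono mult_left_le_one_le) (simp_all add: prob_causal_effect ctrl_prob_def)
    moreover have "0 \<le> ?rest k"
      by (intro sum_nonneg mult_nonneg_nonneg) (simp_all add: prob_causal_effect ctrl_prob_def)
    ultimately show "norm (?rest k) \<le> 1 - ?p k"
      by (simp add: sum_other_ctrl_prob[OF semE compatE c])
  qed
  ultimately show "(\<lambda>k. causal_effect G (?E k) T S t s) \<longlonglongrightarrow> causal_effect (residual c) M' T S t s"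
    using tendsto_add[OF tendsto_mult_left[OF p, of "causal_effect (residual c) M' T S t s"]]
    by fastforce
qed

text \<open>The operator is \<open>F\<close> after \<open>embed_context c\<close>. The embedded law
  need not come from a positive model, so the value of \<open>F\<close> there is computed as a limit
  along the extended models, whose effects converge to that of \<open>M'\<close>.\<close>

lemma residual_if_identifiable:
  assumes T: "T \<inter> C = {}" and S: "S \<subseteq> obs G - C"
    and id: "identifiable D G C L T S" and c: "c \<in> Pi\<^sub>E C D"
  shows "identifiable_dag D (residual c) T S"
  unfolding identifiable_dag_def
proof (intro ballI)
  fix t s assume t: "t \<in> Pi\<^sub>E T D" and s: "s \<in> Pi\<^sub>E S D"
  obtain F where cont: "continuous_on (contextwise_positive_distributions D (obs G) C) F"
    and F: "\<And>M. \<lbrakk>is_sem D G M; compatible D G C L M; positive_sem D G M\<rbrakk>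
      \<Longrightarrow> F (obs_law G M) = causal_effect G M T S t s"
    using id t s unfolding identifiable_def by blast
  have "continuous_on (positive_distributions D (obs (residual c))) (\<lambda>P. F (embed_context c P))"
    by (rule continuous_on_compose2[OF cont continuous_on_embed_context])
      (use embed_context_domain[OF c] in auto)
  moreover have "F (embed_context c (obs_law (residual c) M')) = causal_effect (residual c) M' T S t s"
    if sem: "is_sem D (residual c) M'" and pos: "positive_sem D (residual c) M'" for M'
  proof -
    let ?E = "\<lambda>k. extend_sem c M' (1 / (real k + 2))"
    have semE: "is_sem D G (?E k)" and posE: "positive_sem D G (?E k)" for k
      using is_sem_extend[OF sem] positive_extend[OF sem pos] by simp_all
    have "obs_law (residual c) M' \<in> positive_distributions D (obs G - C)"
      using obs_law_distribution[OF causal_dag_residual sem] pos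
      by (simp add: positive_distributions_def positive_sem_def)
    then have lim_in: "embed_context c (obs_law (residual c) M')
        \<in> contextwise_positive_distributions D (obs G) C"
      by (rule embed_context_domain[OF c])
    have "obs_law G (?E k) \<in> contextwise_positive_distributions D (obs G) C" for k
      using obs_law_distribution[OF dag semE] posE[of k]
      by (simp add: contextwise_positive_distributions_def positive_sem_def)
    then have "(\<lambda>k. F (obs_law G (?E k))) \<longlonglongrightarrow> F (embed_context c (obs_law (residual c) M'))"
      by (intro continuous_on_tendsto_compose[OF cont obs_law_extend_limit[OF sem c] lim_in]) simp
    then show ?thesis
      unfolding F[OF semE compatible_extend posE]
      using causal_effect_extend_limit[OF sem c T S t] by (rule LIMSEQ_unique)
  qed
  ultimately show "\<exists>F. continuous_on (positive_distributions D (obs (residual c))) F \<and>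
      (\<forall>M. is_sem D (residual c) M \<and> positive_sem D (residual c) M
        \<longrightarrow> F (obs_law (residual c) M) = causal_effect (residual c) M T S t s)"
    by blast
qed

end

theorem corollary2:
  fixes D :: "'v \<Rightarrow> 'a set"
    and G :: "'v cgraph"
    and C T S :: "'v set"
    and L :: "('v \<Rightarrow> 'a) \<Rightarrow> ('v \<times> 'v) set"
    and idp :: "'v cgraph \<Rightarrow> 'v set \<Rightarrow> 'v set \<Rightarrow> ('v, 'a) answer"
  assumes "sound_complete_dag_procedure D idp"
    and "causal_dag D G"
    and "C \<subseteq> observed_roots G"
    and "label_set D G C L"
    and "T \<subseteq> obs G - C" and "S \<subseteq> obs G - C" and "T \<inter> S = {}"
  shows "(\<forall>F. algorithm D idp G C L T S = Formula F \<longrightarrow>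
            identifiable D G C L T S \<and>
            (\<forall>M. is_sem D G M \<and> compatible D G C L M \<and> positive_sem D G M \<longrightarrow>
               (\<forall>t\<in>Pi\<^sub>E T D. \<forall>s\<in>Pi\<^sub>E S D. F (obs_law G M) t s = causal_effect G M T S t s))) \<and>
         (algorithm D idp G C L T S = Non_Identifiable \<longrightarrow> \<not> identifiable D G C L T S)"
proof -
  interpret labelled_dag D G C L
    by unfold_locales fact+
  have T: "T \<inter> C = {}" and S: "S \<subseteq> obs G - C" using assms(5,6) by auto
  let ?ans = "\<lambda>c. idp (residual c) T S"
  have proc_sound: "identifiable_dag D (residual c) T S"
      "\<lbrakk>is_sem D (residual c) M; positive_sem D (residual c) M; t \<in> Pi\<^sub>E T D; s \<in> Pi\<^sub>E S D\<rbrakk>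
        \<Longrightarrow> the_formula (?ans c) (obs_law (residual c) M) t s = causal_effect (residual c) M T S t s"
    if formula: "?ans c \<noteq> Non_Identifiable" for c M t s
  proof -
    obtain F where "?ans c = Formula F" using formula by (cases "?ans c") auto
    then show "identifiable_dag D (residual c) T S"
      "\<lbrakk>is_sem D (residual c) M; positive_sem D (residual c) M; t \<in> Pi\<^sub>E T D; s \<in> Pi\<^sub>E S D\<rbrakk>
        \<Longrightarrow> the_formula (?ans c) (obs_law (residual c) M) t s = causal_effect (residual c) M T S t s"
      using assms(1,5-7) causal_dag_residual[of c] by (auto simp: sound_complete_dag_procedure_def)
  qed
  have proc_complete: "\<not> identifiable_dag D (residual c) T S" if "?ans c = Non_Identifiable" for c
    using that assms(1,5-7) causal_dag_residual[of c] by (auto simp: sound_complete_dag_procedure_def)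
  obtain G\<^sub>1 L\<^sub>1 where pr: "prune D C (G, L) = (G\<^sub>1, L\<^sub>1)" by fastforce
  have alg: "algorithm D idp G C L T S =
      (if \<exists>c\<in>Pi\<^sub>E C D. ?ans c = Non_Identifiable then Non_Identifiable
       else Formula (\<lambda>P t s. \<Sum>c\<in>Pi\<^sub>E C D.
         the_formula (?ans c) (context_law D (obs G) C c P) t s * context_prob D (obs G) C c P))"
    \<comment> \<open>The graphs of the algorithm are identified with residual graphs for contexts
      in \<open>Pi\<^sub>E C D\<close> only, hence the congruence rules.\<close>
    by (simp add: algorithm_def pr Let_def context_graph_eq[OF _ pr] cong: bex_cong sum.cong)
  show ?thesis
  proof (cases "\<exists>c\<in>Pi\<^sub>E C D. ?ans c = Non_Identifiable")
    case True
    then have "\<not> identifiable D G C L T S"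
      using proc_complete residual_if_identifiable[OF T S] by blast
    then show ?thesis using True by (simp add: alg)
  next
    case False
    then have "identifiable D G C L T S"
      by (intro identifiable_if_residual[OF T S] proc_sound(1)) blast
    moreover have "(\<Sum>c\<in>Pi\<^sub>E C D. the_formula (?ans c) (context_law D (obs G) C c (obs_law G M)) t s
        * context_prob D (obs G) C c (obs_law G M)) = causal_effect G M T S t s"
      if "is_sem D G M" "compatible D G C L M" "positive_sem D G M" "t \<in> Pi\<^sub>E T D" "s \<in> Pi\<^sub>E S D" for M t s
      using False that
      by (intro causal_effect_formula[OF that(1-3) T S that(4),
            where F = "\<lambda>c P. the_formula (?ans c) P t s"] proc_sound(2)) auto
    ultimately show ?thesis using False by (simp add: alg)
  qed
qed

end
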